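(* Let $m\geq 1$ and let $Z$ be a Banach space of cotype 2. Then $$\mathcal L(^{m+1}\ell_1,\dots,\ell_1,Z;\mathbb K)=\Pi^{mult}_{1,1}(^{m+1} \ell_1,\dots,\ell_1,Z;\mathbb K),$$ i.e. every continuous $(m+1)$-linear form on $\ell_1\times\cdots\times\ell_1\times Z$ ($m$ copies of $\ell_1$) is multiple $(1,1)$-summing.
   Context: Scalars are $\mathbb K=\mathbb R$ or $\mathbb C$. $\mathcal L(^NX_1,\dots,X_N;Y)$ is the space of continuous $N$-linear maps $X_1\times\cdots\times X_N\to Y$. For a sequence $x=(x_i)$ in a Banach space $X$, $\omega_p(x)=\sup_{\|x^*\|\leq 1}\big(\sum_i |x^*(x_i)|^p\big)^{1/p}$. An $N$-linear map $T:X_1\times\cdots\times X_N\to Y$ is multiple $(r,p)$-summing if there is $C>0$ such that for all sequences $x(j)=(x_i(j))_i\subset X_j$, $$\Big(\sum_{i_1,\dots,i_N\in\mathbb N}\|T(x_{i_1}(1),\dots,x_{i_N}(N))\|^r\Big)^{1/r}\leq C\,\omega_p(x(1))\cdots\omega_p(x(N)).$$ $\Pi^{mult}_{r,p}(^NX_1,\dots,X_N;Y)$ is the class of all such (continuous) maps. *)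

theory Defs
  imports "HOL-Analysis.Analysis"
begin

section \<open>Scalars and Banach spaces over them\<close>

text \<open>
  The scalar field is \<open>\<real>\<close> or \<open>\<complex>\<close>, with its usual absolute value. The
  type classes of HOL-Analysis only cover real scalars, so a Banach space over a scalar field
  \<open>'k\<close> is a type of class \<open>banach\<close> together with a scalar multiplication by \<open>'k\<close>.
\<close>

class real_or_complex = real_normed_field + banach +
  assumes real_or_complex:
    "(\<forall>c. \<exists>a. c = a *\<^sub>R 1) \<or>
     (\<exists>i. i * i = - 1 \<and> (\<forall>c. \<exists>a b. c = a *\<^sub>R 1 + b *\<^sub>R i) \<and>
       (\<forall>a b. norm (a *\<^sub>R 1 + b *\<^sub>R i) = sqrt (a\<^sup>2 + b\<^sup>2)))"

instance real :: real_or_complex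
  by standard simp

instance complex :: real_or_complex
proof
  have "\<i> * \<i> = - 1 \<and> (\<forall>c. \<exists>a b. c = a *\<^sub>R 1 + b *\<^sub>R \<i>) \<and>
      (\<forall>a b. norm (a *\<^sub>R 1 + b *\<^sub>R \<i>) = sqrt (a\<^sup>2 + b\<^sup>2))"
  proof (intro conjI allI)
    show "\<exists>a b. c = a *\<^sub>R 1 + b *\<^sub>R \<i>" for c
      by (rule exI[of _ "Re c"], rule exI[of _ "Im c"]) (simp add: complex_eq_iff)
  qed (simp_all add: cmod_def)
  then show "(\<forall>c::complex. \<exists>a. c = a *\<^sub>R 1) \<or>
     (\<exists>i::complex. i * i = - 1 \<and> (\<forall>c. \<exists>a b. c = a *\<^sub>R 1 + b *\<^sub>R i) \<and>
       (\<forall>a b. norm (a *\<^sub>R 1 + b *\<^sub>R i) = sqrt (a\<^sup>2 + b\<^sup>2)))"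
    by blast
qed

locale banach_space_over = vector_space scaleK
  for scaleK :: "'k::real_or_complex \<Rightarrow> 'z::banach \<Rightarrow> 'z" +
  assumes norm_scale: "norm (scaleK c x) = norm c * norm x"
    and scale_of_real: "scaleK (of_real a) x = a *\<^sub>R x"

lemma banach_space_over_mult: "banach_space_over ((*) :: 'k::real_or_complex \<Rightarrow> 'k \<Rightarrow> 'k)"
  by unfold_locales (simp_all add: algebra_simps norm_mult scaleR_conv_of_real)


section \<open>The sequence space \<open>\<ell>\<^sub>1\<close>\<close>

typedef (overloaded) 'k ell1 = "{x :: nat \<Rightarrow> 'k::real_normed_vector. summable (\<lambda>n. norm (x n))}"
  morphisms coord Ell1
  by (rule exI[of _ "\<lambda>_. 0"]) simp

setup_lifting type_definition_ell1

lemma summable_coord: "summable (\<lambda>n. norm (coord x n))"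
  using coord[of x] by simp

lemma ell1_eqI: "(\<And>n. coord x n = coord y n) \<Longrightarrow> x = y"
  by (metis coord_inject ext)

lemma ell1_summable_add:
  fixes x y :: "nat \<Rightarrow> 'k::real_normed_vector"
  assumes "summable (\<lambda>n. norm (x n))" "summable (\<lambda>n. norm (y n))"
  shows "summable (\<lambda>n. norm (x n + y n))"
  by (rule summable_comparison_test'[OF summable_add[OF assms], where N = 0])
     (simp add: norm_triangle_ineq)

lemma ell1_summable_diff:
  fixes x y :: "nat \<Rightarrow> 'k::real_normed_vector"
  assumes "summable (\<lambda>n. norm (x n))" "summable (\<lambda>n. norm (y n))"
  shows "summable (\<lambda>n. norm (x n - y n))"
  using ell1_summable_add[of x "\<lambda>n. - y n"] assms by simp

instantiation ell1 :: (real_normed_vector) real_normed_vector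
begin

lift_definition zero_ell1 :: "'a ell1" is "\<lambda>_. 0" by simp
lift_definition plus_ell1 :: "'a ell1 \<Rightarrow> 'a ell1 \<Rightarrow> 'a ell1" is "\<lambda>x y n. x n + y n"
  by (rule ell1_summable_add)
lift_definition minus_ell1 :: "'a ell1 \<Rightarrow> 'a ell1 \<Rightarrow> 'a ell1" is "\<lambda>x y n. x n - y n"
  by (rule ell1_summable_diff)
lift_definition uminus_ell1 :: "'a ell1 \<Rightarrow> 'a ell1" is "\<lambda>x n. - x n" by simp
lift_definition scaleR_ell1 :: "real \<Rightarrow> 'a ell1 \<Rightarrow> 'a ell1" is "\<lambda>a x n. a *\<^sub>R x n"
  by (simp add: summable_mult)
lift_definition norm_ell1 :: "'a ell1 \<Rightarrow> real" is "\<lambda>x. \<Sum>n. norm (x n)" .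

definition dist_ell1 :: "'a ell1 \<Rightarrow> 'a ell1 \<Rightarrow> real" where "dist_ell1 x y = norm (x - y)"
definition sgn_ell1 :: "'a ell1 \<Rightarrow> 'a ell1" where "sgn_ell1 x = inverse (norm x) *\<^sub>R x"
definition uniformity_ell1 :: "('a ell1 \<times> 'a ell1) filter" where
  "uniformity_ell1 = (INF e\<in>{0<..}. principal {(x, y). dist x y < e})"
definition open_ell1 :: "'a ell1 set \<Rightarrow> bool" where
  "open_ell1 U = (\<forall>x\<in>U. eventually (\<lambda>(x', y). x' = x \<longrightarrow> y \<in> U) uniformity)"

instance
proof
  fix x y z :: "'a ell1" and a b :: real
  show "x + y + z = x + (y + z)" by transfer (simp add: add.assoc)
  show "x + y = y + x" by transfer (simp add: add.commute)
  show "0 + x = x" by transfer simp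
  show "- x + x = 0" by transfer simp
  show "x - y = x + - y" by transfer simp
  show "a *\<^sub>R (x + y) = a *\<^sub>R x + a *\<^sub>R y" by transfer (simp add: scaleR_add_right)
  show "(a + b) *\<^sub>R x = a *\<^sub>R x + b *\<^sub>R x" by transfer (simp add: scaleR_add_left)
  show "a *\<^sub>R b *\<^sub>R x = (a * b) *\<^sub>R x" by transfer simp
  show "1 *\<^sub>R x = x" by transfer simp
  show "norm x = 0 \<longleftrightarrow> x = 0"
    by transfer (auto simp: suminf_eq_zero_iff fun_eq_iff)
  show "norm (x + y) \<le> norm x + norm y"
  proof transfer
    fix x y :: "nat \<Rightarrow> 'a"
    assume *: "summable (\<lambda>n. norm (x n))" "summable (\<lambda>n. norm (y n))"
    have "(\<Sum>n. norm (x n + y n)) \<le> (\<Sum>n. norm (x n) + norm (y n))"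
      by (intro suminf_le norm_triangle_ineq ell1_summable_add summable_add *)
    then show "(\<Sum>n. norm (x n + y n)) \<le> (\<Sum>n. norm (x n)) + (\<Sum>n. norm (y n))"
      by (simp add: suminf_add[OF *])
  qed
  show "norm (a *\<^sub>R x) = \<bar>a\<bar> * norm x"
    by transfer (simp add: suminf_mult)
qed (rule dist_ell1_def sgn_ell1_def uniformity_ell1_def open_ell1_def)+

end

lemma norm_coord_le: "norm (coord x n) \<le> norm x"
  using sum_le_suminf[OF summable_coord[of x], of "{n}"] by (simp add: norm_ell1.rep_eq)

instance ell1 :: (banach) banach
proof
  fix X :: "nat \<Rightarrow> 'a ell1" assume X: "Cauchy X"
  have "Cauchy (\<lambda>k. coord (X k) n)" for n
  proof (rule metric_CauchyI)
    fix e :: real assume "e > 0"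
    then obtain M where M: "\<And>j k. j \<ge> M \<Longrightarrow> k \<ge> M \<Longrightarrow> dist (X j) (X k) < e"
      using metric_CauchyD[OF X] by blast
    have "dist (coord (X j) n) (coord (X k) n) \<le> dist (X j) (X k)" for j k
      using norm_coord_le[of "X j - X k" n] by (simp add: dist_norm minus_ell1.rep_eq)
    then show "\<exists>M. \<forall>j\<ge>M. \<forall>k\<ge>M. dist (coord (X j) n) (coord (X k) n) < e"
      using M by (meson le_less_trans)
  qed
  then have "\<exists>l. (\<lambda>k. coord (X k) n) \<longlonglongrightarrow> l" for n
    by (simp add: Cauchy_convergent_iff convergent_def)
  then obtain l where l: "\<And>n. (\<lambda>k. coord (X k) n) \<longlonglongrightarrow> l n" by metis
  have part: "(\<Sum>n<N. norm (coord (X k) n - l n)) \<le> e"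
    if M: "\<And>i j. i \<ge> M \<Longrightarrow> j \<ge> M \<Longrightarrow> dist (X i) (X j) < e" and "k \<ge> M" for M k N e
  proof (rule tendsto_upperbound)
    show "(\<lambda>j. \<Sum>n<N. norm (coord (X k) n - coord (X j) n))
        \<longlonglongrightarrow> (\<Sum>n<N. norm (coord (X k) n - l n))"
      by (intro tendsto_intros l)
    have "(\<Sum>n<N. norm (coord (X k) n - coord (X j) n)) \<le> e" if "j \<ge> M" for j
    proof -
      have "(\<Sum>n<N. norm (coord (X k - X j) n)) \<le> norm (X k - X j)"
        unfolding norm_ell1.rep_eq by (rule sum_le_suminf) (auto simp: summable_coord)
      then show ?thesis
        using M[OF \<open>k \<ge> M\<close> that] by (simp add: dist_norm minus_ell1.rep_eq)
    qed
    then show "\<forall>\<^sub>F j in sequentially. (\<Sum>n<N. norm (coord (X k) n - coord (X j) n)) \<le> e"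
      unfolding eventually_sequentially by blast
  qed simp
  have diff: "summable (\<lambda>n. norm (coord (X k) n - l n)) \<and> (\<Sum>n. norm (coord (X k) n - l n)) \<le> e"
    if "\<And>i j. i \<ge> M \<Longrightarrow> j \<ge> M \<Longrightarrow> dist (X i) (X j) < e" and "k \<ge> M" for M k e
  proof -
    have *: "summable (\<lambda>n. norm (coord (X k) n - l n))"
      by (rule summableI_nonneg_bounded[where x = e]) (use part[OF that] in auto)
    then show ?thesis
      using suminf_le_const[OF *] part[OF that] by blast
  qed
  obtain M1 where M1: "\<And>i j. i \<ge> M1 \<Longrightarrow> j \<ge> M1 \<Longrightarrow> dist (X i) (X j) < 1"
    using metric_CauchyD[OF X, of 1] by auto
  have "summable (\<lambda>n. norm (l n))"
    using ell1_summable_diff[OF summable_coord[of "X M1"], of "\<lambda>n. coord (X M1) n - l n"]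
      diff[OF M1, of M1] by simp
  then have L: "coord (Ell1 l) = l" by (simp add: Ell1_inverse)
  have "X \<longlonglongrightarrow> Ell1 l"
  proof (rule metric_LIMSEQ_I)
    fix e :: real assume "e > 0"
    then obtain M where M: "\<And>j k. j \<ge> M \<Longrightarrow> k \<ge> M \<Longrightarrow> dist (X j) (X k) < e / 2"
      using metric_CauchyD[OF X, of "e / 2"] by auto
    have "dist (X k) (Ell1 l) < e" if "k \<ge> M" for k
      using diff[OF M that] \<open>e > 0\<close> by (simp add: dist_norm norm_ell1.rep_eq minus_ell1.rep_eq L)
    then show "\<exists>M. \<forall>k\<ge>M. dist (X k) (Ell1 l) < e" by blast
  qed
  then show "convergent X" by (rule convergentI)
qed

lift_definition scale_ell1 :: "'k::real_normed_field \<Rightarrow> 'k ell1 \<Rightarrow> 'k ell1" is "\<lambda>c x n. c * x n"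
  by (simp add: norm_mult summable_mult)

lemma banach_space_over_ell1:
  "banach_space_over (scale_ell1 :: 'k::real_or_complex \<Rightarrow> 'k ell1 \<Rightarrow> 'k ell1)"
proof unfold_locales
  fix c d :: 'k and a :: real and x y :: "'k ell1"
  show "scale_ell1 c (x + y) = scale_ell1 c x + scale_ell1 c y"
    by transfer (simp add: algebra_simps)
  show "scale_ell1 (c + d) x = scale_ell1 c x + scale_ell1 d x"
    by transfer (simp add: algebra_simps)
  show "scale_ell1 c (scale_ell1 d x) = scale_ell1 (c * d) x"
    by transfer (simp add: algebra_simps)
  show "scale_ell1 1 x = x" by transfer simp
  show "norm (scale_ell1 c x) = norm c * norm x"
    by transfer (simp add: norm_mult suminf_mult)
  show "scale_ell1 (of_real a) x = a *\<^sub>R x"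
    by transfer (simp add: scaleR_conv_of_real)
qed


section \<open>Cotype\<close>

text \<open>
  The right-hand side is the \<open>L\<^sub>2\<close>-average of the Rademacher sums
  \<open>\<epsilon> 0 x 0 + \<dots> + \<epsilon> (n - 1) x (n - 1)\<close> over the \<open>2 ^ n\<close> choices of signs.
\<close>

definition has_cotype :: "real \<Rightarrow> 'z::real_normed_vector itself \<Rightarrow> bool" where
  "has_cotype q (_ :: 'z itself) \<longleftrightarrow>
     (\<exists>C>0. \<forall>(n::nat) (x :: nat \<Rightarrow> 'z).
        (\<Sum>j<n. norm (x j) powr q) powr (1 / q) \<le>
        C * sqrt ((\<Sum>\<epsilon>\<in>{..<n} \<rightarrow>\<^sub>E {-1, 1}. (norm (\<Sum>j<n. \<epsilon> j *\<^sub>R x j))\<^sup>2) / 2 ^ n))"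


section \<open>Multiple summing maps\<close>

definition ennpowr :: "ennreal \<Rightarrow> real \<Rightarrow> ennreal" where
  "ennpowr t a = (if t = \<infinity> then \<infinity> else ennreal (enn2real t powr a))"

definition dual_ball :: "('k::real_or_complex \<Rightarrow> 'x::real_normed_vector \<Rightarrow> 'x) \<Rightarrow> ('x \<Rightarrow> 'k) set" where
  "dual_ball scaleK = {f. Vector_Spaces.linear scaleK (*) f \<and> bounded_linear f \<and> onorm f \<le> 1}"

text \<open>The weak norm \<open>\<omega>\<^sub>p\<close>; its value is \<open>\<infinity>\<close> on sequences that are not weakly \<open>p\<close>-summable.\<close>

definition weak_norm ::
    "real \<Rightarrow> ('k::real_or_complex \<Rightarrow> 'x::real_normed_vector \<Rightarrow> 'x) \<Rightarrow> (nat \<Rightarrow> 'x) \<Rightarrow> ennreal" where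
  "weak_norm p scaleK x =
     (SUP f\<in>dual_ball scaleK. ennpowr (\<Sum>\<^sub>\<infinity>i. ennreal (norm (f (x i)) powr p)) (1 / p))"

text \<open>
  Maps in \<open>m + 1\<close> variables, the first \<open>m = CARD('m)\<close> of them from the same space \<open>'x\<close> and the
  last one from \<open>'z\<close>, are functions on \<open>('x ^ 'm) \<times> 'z\<close>. As \<open>'m\<close> is an arbitrary finite type,
  and types are nonempty, \<open>m\<close> ranges over all integers \<open>\<ge> 1\<close>.
\<close>

definition continuous_multilinear ::
    "('k::real_or_complex \<Rightarrow> 'x::real_normed_vector \<Rightarrow> 'x) \<Rightarrow>
     ('k \<Rightarrow> 'z::real_normed_vector \<Rightarrow> 'z) \<Rightarrow>
     ('k \<Rightarrow> 'y::real_normed_vector \<Rightarrow> 'y) \<Rightarrow> (('x ^ 'm::finite) \<times> 'z \<Rightarrow> 'y) set" where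
  "continuous_multilinear scaleX scaleZ scaleY =
     {T. (\<forall>x z j. Vector_Spaces.linear scaleX scaleY
                    (\<lambda>u. T (\<chi> i. if i = j then u else x $ i, z))) \<and>
         (\<forall>x. Vector_Spaces.linear scaleZ scaleY (\<lambda>z. T (x, z))) \<and>
         continuous_on UNIV T}"

definition multiple_summing ::
    "real \<Rightarrow> real \<Rightarrow> ('k::real_or_complex \<Rightarrow> 'x::real_normed_vector \<Rightarrow> 'x) \<Rightarrow>
     ('k \<Rightarrow> 'z::real_normed_vector \<Rightarrow> 'z) \<Rightarrow>
     ('k \<Rightarrow> 'y::real_normed_vector \<Rightarrow> 'y) \<Rightarrow> (('x ^ 'm::finite) \<times> 'z \<Rightarrow> 'y) set" where
  "multiple_summing r p scaleX scaleZ scaleY =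
     {T \<in> continuous_multilinear scaleX scaleZ scaleY.
        \<exists>C::real. C > 0 \<and> (\<forall>(x :: 'm \<Rightarrow> nat \<Rightarrow> 'x) (z :: nat \<Rightarrow> 'z).
          ennpowr (\<Sum>\<^sub>\<infinity>(i :: 'm \<Rightarrow> nat, k :: nat)\<in>UNIV. ennreal (norm (T (\<chi> j. x j (i j), z k)) powr r)) (1 / r)
            \<le> ennreal C * (\<Prod>j\<in>UNIV. weak_norm p scaleX (x j)) * weak_norm p scaleZ z)}"

end

theory Submission
  imports Defs
begin

text \<open>
  Let \<open>z\<close> be weakly summable in \<open>Z\<close> and put \<open>W g = \<Sum>t. g t z\<^sub>t\<close> on \<open>\<ell>\<^sub>\<infinity>\<close>. Cotype 2 makes \<open>W\<close>
  2-summing, and Grothendieck's theorem makes the coordinate matrix \<open>X\<close> of a weakly summable sequence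
  in \<open>\<ell>\<^sub>1\<close> a bounded operator from \<open>\<ell>\<^sub>\<infinity>(\<ell>\<^sub>2)\<close> to \<open>\<ell>\<^sub>1(\<ell>\<^sub>2)\<close>. Both follow from one argument: in a
  Rademacher sum, the part truncated at a constant level is controlled by the operator norm, and the
  tail, small in \<open>L\<^sub>2\<close>, by the best constant itself, whence \<open>Q \<le> c + Q / 2\<close>. Maurey's factorisation of
  \<open>X\<close> through \<open>\<ell>\<^sub>2\<close> then allows one to tensor \<open>W\<close> with the matrices \<open>X\<^sub>1, \<dots>, X\<^sub>m\<close> one at a
  time. Applied to the array of phases of the numbers \<open>T(x\<^sub>i, z\<^sub>t)\<close>, the resulting estimate bounds
  the sum of their absolute values.
\<close>

section \<open>Rademacher sums of scalars\<close>

text \<open>The obstacle lies in tensoring. For a fixed row \<open>b\<close>, the estimate already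
  known for \<Psi> sees the array only through a supremum over \<open>t\<close>, whereas
  Grothendieck's theorem bounds the supremum over \<open>t\<close> of sums over \<open>b\<close>,
  not the sum over \<open>b\<close> of suprema. Maurey's weights close this gap: they provide one
  weighted family, indexed by \<open>b\<close> and \<open>s\<close> together, that is admissible at
  every \<open>t\<close> at once. To survive iteration, the estimate has to keep an \<ell>_1 sum
  over the output index and an \<ell>_2 norm over a family of arbitrary length. This invariant is
  \<open>mixed_summing\<close>; the final array of phases is merely a family of length one. The form
  \<open>T\<close> enters only through a bound \<open>B\<close> for its values at unit vectors of
  \<ell>_1. The resulting constant is \<open>B\<close> times \<open>8 * C\<^sup>2\<close> for the
  cotype step, times 64 for each factor \<ell>_1.\<close>

lemma parallelogram_law_real_or_complex:
  fixes a b :: "'k::real_or_complex"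
  shows "(norm (a + b))\<^sup>2 + (norm (a - b))\<^sup>2 = 2 * (norm a)\<^sup>2 + 2 * (norm b)\<^sup>2"
  using real_or_complex[where 'a = 'k]
proof
  assume *: "\<forall>c::'k. \<exists>a. c = a *\<^sub>R 1"
  obtain x y where xy: "a = x *\<^sub>R 1" "b = y *\<^sub>R 1" using * by metis
  then have "norm (a + b) = \<bar>x + y\<bar>" "norm (a - b) = \<bar>x - y\<bar>"
    by (simp_all flip: scaleR_add_left scaleR_diff_left)
  then show ?thesis using xy by (simp add: power2_eq_square algebra_simps)
next
  assume "\<exists>i::'k. i * i = - 1 \<and> (\<forall>c. \<exists>a b. c = a *\<^sub>R 1 + b *\<^sub>R i) \<and>
       (\<forall>a b. norm (a *\<^sub>R 1 + b *\<^sub>R i) = sqrt (a\<^sup>2 + b\<^sup>2))"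
  then obtain i :: 'k where c: "\<And>c. \<exists>a b. c = a *\<^sub>R 1 + b *\<^sub>R i"
    and n: "\<And>a b. norm (a *\<^sub>R 1 + b *\<^sub>R i) = sqrt (a\<^sup>2 + b\<^sup>2)" by blast
  obtain x y where a: "a = x *\<^sub>R 1 + y *\<^sub>R i" using c by blast
  obtain u v where b: "b = u *\<^sub>R 1 + v *\<^sub>R i" using c by blast
  have "a + b = (x + u) *\<^sub>R 1 + (y + v) *\<^sub>R i" "a - b = (x - u) *\<^sub>R 1 + (y - v) *\<^sub>R i"
    unfolding a b by (simp_all add: scaleR_add_left scaleR_diff_left)
  then have "norm (a + b) = sqrt ((x + u)\<^sup>2 + (y + v)\<^sup>2)"
      "norm (a - b) = sqrt ((x - u)\<^sup>2 + (y - v)\<^sup>2)" by (simp_all only: n)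
  moreover have "norm a = sqrt (x\<^sup>2 + y\<^sup>2)" "norm b = sqrt (u\<^sup>2 + v\<^sup>2)"
    unfolding a b by (rule n)+
  ultimately show ?thesis by simp (simp add: power2_eq_square algebra_simps)
qed

text \<open>The parallelogram law fixes the sum of the squared norms \<open>P\<close> and
  \<open>M\<close>, the triangle inequality bounds their difference by
  \<open>4 * (norm a * norm b)\<close>, and sum and difference determine
  \<open>P\<^sup>2 + M\<^sup>2\<close>.\<close>

lemma fourth_power_parallelogram:
  fixes a b :: "'k::real_or_complex"
  shows "norm (a + b) ^ 4 + norm (a - b) ^ 4
    \<le> 2 * (norm a ^ 4 + 6 * ((norm a)\<^sup>2 * (norm b)\<^sup>2) + norm b ^ 4)"
proof -
  define P where "P = (norm (a + b))\<^sup>2"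
  define M where "M = (norm (a - b))\<^sup>2"
  have PM: "P + M = 2 * ((norm a)\<^sup>2 + (norm b)\<^sup>2)"
    using parallelogram_law_real_or_complex[of a b] by (simp add: P_def M_def)
  have "P \<le> (norm a + norm b)\<^sup>2" "M \<le> (norm a + norm b)\<^sup>2"
    unfolding P_def M_def by (intro power_mono norm_triangle_ineq norm_triangle_ineq4; simp)+
  then have "\<bar>P - M\<bar> \<le> 4 * (norm a * norm b)"
    using PM by (auto simp: power2_eq_square algebra_simps abs_le_iff)
  then have "(P - M)\<^sup>2 \<le> (4 * (norm a * norm b))\<^sup>2" by (rule abs_le_square_iff[THEN iffD1, OF order_trans]) simp
  then have "(P - M)\<^sup>2 \<le> 16 * ((norm a)\<^sup>2 * (norm b)\<^sup>2)" by (simp add: power_mult_distrib)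
  moreover have "2 * (P\<^sup>2 + M\<^sup>2) = (P + M)\<^sup>2 + (P - M)\<^sup>2"
    by (simp add: power2_eq_square algebra_simps)
  moreover have "(P + M)\<^sup>2 = 4 * (norm a ^ 4 + 2 * ((norm a)\<^sup>2 * (norm b)\<^sup>2) + norm b ^ 4)"
    unfolding PM by (simp add: power2_eq_square power4_eq_xxxx algebra_simps)
  moreover have "norm (a + b) ^ 4 = P\<^sup>2" "norm (a - b) ^ 4 = M\<^sup>2"
    by (simp_all add: P_def M_def)
  ultimately show ?thesis by simp
qed

definition signs :: "'s set \<Rightarrow> ('s \<Rightarrow> real) set" where
  "signs S = S \<rightarrow>\<^sub>E {- 1, 1}"

lemma finite_signs: "finite S \<Longrightarrow> finite (signs S)"
  by (auto simp: signs_def intro: finite_PiE)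

lemma card_signs: "finite S \<Longrightarrow> card (signs S) = 2 ^ card S"
  by (simp add: signs_def card_PiE prod_constant numeral_2_eq_2)

lemma sum_PiE_insert:
  fixes g :: "('s \<Rightarrow> 'b) \<Rightarrow> 'c::comm_monoid_add"
  assumes "x \<notin> S"
  shows "(\<Sum>r\<in>insert x S \<rightarrow>\<^sub>E B. g r) = (\<Sum>b\<in>B. \<Sum>r\<in>S \<rightarrow>\<^sub>E B. g (r(x := b)))"
proof -
  have "(\<Sum>r\<in>insert x S \<rightarrow>\<^sub>E B. g r) = (\<Sum>(b, r)\<in>B \<times> (S \<rightarrow>\<^sub>E B). g (r(x := b)))"
    unfolding PiE_insert_eq
    by (subst sum.reindex) (auto intro!: inj_combinator assms simp: case_prod_beta)
  then show ?thesis by (simp add: sum.cartesian_product)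
qed

definition rademacher :: "'s set \<Rightarrow> ('s \<Rightarrow> 'v::real_normed_vector) \<Rightarrow> ('s \<Rightarrow> real) \<Rightarrow> 'v" where
  "rademacher S v r = (\<Sum>s\<in>S. r s *\<^sub>R v s)"

lemma sum_signs_insert:
  assumes "finite S" "x \<notin> S"
  shows "(\<Sum>r\<in>signs (insert x S). g (rademacher (insert x S) v r)) =
    (\<Sum>r\<in>signs S. g (rademacher S v r + v x) + g (rademacher S v r - v x))"
proof -
  have *: "rademacher (insert x S) v (r(x := b)) = rademacher S v r + b *\<^sub>R v x" for r b
    unfolding rademacher_def using assms by (simp add: add.commute) (auto intro: sum.cong)
  show ?thesis
    unfolding signs_def sum_PiE_insert[OF assms(2)]
    by (simp add: * sum.distrib algebra_simps)
qed

lemma rademacher_second_moment: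
  fixes v :: "'s \<Rightarrow> 'k::real_or_complex"
  assumes "finite S"
  shows "(\<Sum>r\<in>signs S. (norm (rademacher S v r))\<^sup>2) = 2 ^ card S * (\<Sum>s\<in>S. (norm (v s))\<^sup>2)"
  using assms
proof induction
  case empty
  then show ?case by (simp add: rademacher_def)
next
  case (insert x S)
  show ?case
    unfolding sum_signs_insert[OF insert.hyps, where g = "\<lambda>u. (norm u)\<^sup>2"]
      parallelogram_law_real_or_complex
    using insert by (simp add: sum.distrib card_signs sum_distrib_left[symmetric] algebra_simps)
qed

lemma rademacher_fourth_moment:
  fixes v :: "'s \<Rightarrow> 'k::real_or_complex"
  assumes "finite S"
  shows "(\<Sum>r\<in>signs S. norm (rademacher S v r) ^ 4)
    \<le> 3 * 2 ^ card S * (\<Sum>s\<in>S. (norm (v s))\<^sup>2)\<^sup>2"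
  using assms
proof induction
  case empty
  then show ?case by (simp add: rademacher_def)
next
  case (insert x S)
  let ?s = "\<Sum>s\<in>S. (norm (v s))\<^sup>2"
  have "(\<Sum>r\<in>signs (insert x S). norm (rademacher (insert x S) v r) ^ 4)
     \<le> (\<Sum>r\<in>signs S. 2 * (norm (rademacher S v r) ^ 4
          + 6 * ((norm (rademacher S v r))\<^sup>2 * (norm (v x))\<^sup>2) + norm (v x) ^ 4))"
    unfolding sum_signs_insert[OF insert.hyps, where g = "\<lambda>u. norm u ^ 4"]
    by (intro sum_mono fourth_power_parallelogram)
  also have "\<dots> = 2 * (\<Sum>r\<in>signs S. norm (rademacher S v r) ^ 4)
      + 12 * (norm (v x))\<^sup>2 * (\<Sum>r\<in>signs S. (norm (rademacher S v r))\<^sup>2)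
      + 2 * 2 ^ card S * norm (v x) ^ 4"
    using insert.hyps
    by (simp add: sum.distrib sum_distrib_left card_signs algebra_simps)
  \<comment> \<open>Raising the coefficient 2 of the last term to 6 completes a square; the constant
    3 is the one that fits the mixed term 12.\<close>
  also have "\<dots> \<le> 2 * (3 * 2 ^ card S * ?s\<^sup>2) + 12 * (norm (v x))\<^sup>2 * (2 ^ card S * ?s)
      + 6 * 2 ^ card S * norm (v x) ^ 4"
    unfolding rademacher_second_moment[OF insert.hyps(1)]
    by (intro add_mono mult_left_mono insert.IH) auto
  also have "\<dots> = 3 * 2 ^ card (insert x S) * (\<Sum>s\<in>insert x S. (norm (v s))\<^sup>2)\<^sup>2"
    using insert.hyps by (simp add: power2_eq_square power4_eq_xxxx algebra_simps)
  finally show ?case .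
qed

lemma khinchine_L1:
  fixes v :: "'s \<Rightarrow> 'k::real_or_complex"
  assumes "finite S"
  shows "sqrt (\<Sum>s\<in>S. (norm (v s))\<^sup>2) * 2 ^ card S \<le> 2 * (\<Sum>r\<in>signs S. norm (rademacher S v r))"
proof (cases "(\<Sum>s\<in>S. (norm (v s))\<^sup>2) = 0")
  case True
  then show ?thesis by (simp add: sum_nonneg)
next
  case False
  define \<sigma> where "\<sigma> = sqrt (\<Sum>s\<in>S. (norm (v s))\<^sup>2)"
  have "(\<Sum>s\<in>S. (norm (v s))\<^sup>2) > 0" using False by (simp add: sum_nonneg order_less_le)
  then have \<sigma>: "\<sigma> > 0" "\<sigma>\<^sup>2 = (\<Sum>s\<in>S. (norm (v s))\<^sup>2)" by (auto simp: \<sigma>_def)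
  \<comment> \<open>The first moment is recovered from the second and the fourth by averaging a
    polynomial minorant, which touches the line at \<open>2 * \<sigma>\<close>. The average leaves
    3/4 - 3/16 = 9/16, more than the required 1/2.\<close>
  have pw: "3 / 4 * \<sigma>\<^sup>2 * x\<^sup>2 - x ^ 4 / 16 \<le> \<sigma> ^ 3 * x" if "x \<ge> 0" for x
  proof -
    have "0 \<le> x * ((x - 2 * \<sigma>)\<^sup>2 * (x + 4 * \<sigma>))" using that \<sigma> by simp
    also have "\<dots> = 16 * \<sigma> ^ 3 * x - 12 * \<sigma>\<^sup>2 * x\<^sup>2 + x ^ 4"
      by (simp add: power2_eq_square power3_eq_cube power4_eq_xxxx algebra_simps)
    finally show ?thesis by simp
  qed
  have "9 / 16 * \<sigma> ^ 4 * 2 ^ card S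
    \<le> 3 / 4 * \<sigma>\<^sup>2 * (\<Sum>r\<in>signs S. (norm (rademacher S v r))\<^sup>2)
      - (\<Sum>r\<in>signs S. norm (rademacher S v r) ^ 4) / 16"
    using rademacher_fourth_moment[OF assms, of v]
    unfolding rademacher_second_moment[OF assms] \<sigma>(2)[symmetric]
    by (simp add: power2_eq_square power4_eq_xxxx algebra_simps)
  also have "\<dots> = (\<Sum>r\<in>signs S. 3 / 4 * \<sigma>\<^sup>2 * (norm (rademacher S v r))\<^sup>2
      - norm (rademacher S v r) ^ 4 / 16)"
    by (simp add: sum_subtractf sum_distrib_left sum_divide_distrib)
  also have "\<dots> \<le> (\<Sum>r\<in>signs S. \<sigma> ^ 3 * norm (rademacher S v r))"
    by (intro sum_mono pw) simp
  finally have "\<sigma> ^ 3 * (9 / 16 * \<sigma> * 2 ^ card S) \<le> \<sigma> ^ 3 * (\<Sum>r\<in>signs S. norm (rademacher S v r))"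
    by (simp add: sum_distrib_left power3_eq_cube power4_eq_xxxx algebra_simps)
  then have "9 / 16 * \<sigma> * 2 ^ card S \<le> (\<Sum>r\<in>signs S. norm (rademacher S v r))"
    using \<sigma>(1) by simp
  moreover have "\<sigma> * 2 ^ card S \<ge> 0" using \<sigma>(1) by simp
  ultimately show ?thesis unfolding \<sigma>_def[symmetric] by linarith
qed

section \<open>Tails of Rademacher sums and the absorption argument\<close>

definition tail :: "real \<Rightarrow> 'v::real_normed_vector \<Rightarrow> 'v" where
  "tail M u = (if norm u \<le> M then 0 else u)"

lemma norm_diff_tail: "M \<ge> 0 \<Longrightarrow> norm (u - tail M u) \<le> M"
  by (simp add: tail_def)

text \<open>Where the tail survives, \<open>(2 * D)\<^sup>2 * (norm u)\<^sup>2\<close> is at most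
  \<open>norm u ^ 4\<close>. The doubled level produces a factor 4, which absorbs the 3 of the
  fourth moment bound.\<close>

lemma rademacher_tail:
  fixes v :: "'s \<Rightarrow> 'k::real_or_complex"
  assumes "finite S" "(\<Sum>s\<in>S. (norm (v s))\<^sup>2) \<le> 1" "D > 0"
  shows "(\<Sum>r\<in>signs S. (norm (tail (2 * D) (rademacher S v r)))\<^sup>2) \<le> 2 ^ card S / D\<^sup>2"
proof -
  have "(2 * D)\<^sup>2 * (norm (tail (2 * D) u))\<^sup>2 \<le> norm u ^ 4" for u :: 'k
  proof (cases "norm u \<le> 2 * D")
    case False
    then have "(2 * D)\<^sup>2 * (norm u)\<^sup>2 \<le> (norm u)\<^sup>2 * (norm u)\<^sup>2"
      using assms(3) by (intro mult_right_mono power_mono) auto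
    then show ?thesis using False by (simp add: tail_def flip: power_add)
  qed (simp add: tail_def)
  then have "(2 * D)\<^sup>2 * (\<Sum>r\<in>signs S. (norm (tail (2 * D) (rademacher S v r)))\<^sup>2)
      \<le> (\<Sum>r\<in>signs S. norm (rademacher S v r) ^ 4)"
    unfolding sum_distrib_left by (intro sum_mono)
  also have "\<dots> \<le> 3 * 2 ^ card S * 1\<^sup>2"
    using rademacher_fourth_moment[OF assms(1), of v]
    by (rule order_trans) (intro mult_left_mono power_mono assms sum_nonneg; simp)
  also have "\<dots> \<le> 4 * 2 ^ card S" by simp
  finally show ?thesis using assms(3) by (simp add: field_simps power_mult_distrib)
qed

text \<open>The hypothesis \<open>improve\<close> is applied to the supremum itself. The a priori
  bound \<open>Q0\<close> guarantees that this supremum is finite; its size does not reach the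
  conclusion.\<close>

lemma self_improvement:
  fixes f :: "'a \<Rightarrow> real"
  assumes bounded: "\<And>x. x \<in> D \<Longrightarrow> f x \<le> Q0"
    and improve: "\<And>Q. (\<And>x. x \<in> D \<Longrightarrow> f x \<le> Q) \<Longrightarrow> (\<And>x. x \<in> D \<Longrightarrow> f x \<le> c + Q / 2)"
    and "x \<in> D"
  shows "f x \<le> 2 * c"
proof -
  have bdd: "bdd_above (f ` D)" using bounded by (auto intro!: bdd_aboveI)
  let ?Q = "SUP x\<in>D. f x"
  have le: "f x \<le> ?Q" if "x \<in> D" for x by (rule cSUP_upper[OF that bdd])
  have "?Q \<le> c + ?Q / 2" using \<open>x \<in> D\<close> improve[OF le] by (intro cSUP_least) auto
  then show ?thesis using le[OF \<open>x \<in> D\<close>] by simp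
qed

section \<open>Self-improvement by truncation\<close>

text \<open>Real linearity suffices: signs, normalisations and factorisation weights are all
  real.\<close>

definition fun_linear :: "(('t \<Rightarrow> 'k::real_vector) \<Rightarrow> 'v::real_vector) \<Rightarrow> bool" where
  "fun_linear \<Psi> \<longleftrightarrow> (\<forall>f g. \<Psi> (\<lambda>t. f t + g t) = \<Psi> f + \<Psi> g) \<and>
     (\<forall>c f. \<Psi> (\<lambda>t. c *\<^sub>R f t) = c *\<^sub>R \<Psi> f)"

lemma fun_linear_add: "fun_linear \<Psi> \<Longrightarrow> \<Psi> (\<lambda>t. f t + g t) = \<Psi> f + \<Psi> g"
  and fun_linear_scaleR: "fun_linear \<Psi> \<Longrightarrow> \<Psi> (\<lambda>t. c *\<^sub>R f t) = c *\<^sub>R \<Psi> f"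
  by (auto simp: fun_linear_def)

lemma fun_linear_diff:
  assumes "fun_linear \<Psi>"
  shows "\<Psi> (\<lambda>t. f t - g t) = \<Psi> f - \<Psi> g"
  using fun_linear_add[OF assms, of f "\<lambda>t. (- 1) *\<^sub>R g t"] fun_linear_scaleR[OF assms, of "- 1" g]
  by simp

lemma fun_linear_rademacher:
  assumes "fun_linear \<Psi>"
  shows "\<Psi> (\<lambda>t. rademacher S (\<lambda>s. y s t) r) = rademacher S (\<lambda>s. \<Psi> (y s)) r"
proof (induction S rule: infinite_finite_induct)
  case (insert x F)
  then show ?case
    by (simp add: rademacher_def fun_linear_add[OF assms] fun_linear_scaleR[OF assms])
qed (use fun_linear_scaleR[OF assms, of 0] in \<open>simp_all add: rademacher_def\<close>)

text \<open>For linear \<Psi> and finite index sets: norm at most \<open>R\<close> as an operator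
  from \<ell>_\<infinity> over \<open>T\<close> to the \<ell>_1 sum over \<open>A\<close>. With
  \<open>A = {()}\<close> it is a single operator into \<open>'v\<close>.\<close>

definition linf_bounded ::
    "'a set \<Rightarrow> 't set \<Rightarrow> ('a \<Rightarrow> ('t \<Rightarrow> 'k::real_normed_vector) \<Rightarrow> 'v::real_normed_vector) \<Rightarrow> real \<Rightarrow> bool" where
  "linf_bounded A T \<Psi> R \<longleftrightarrow> (\<forall>g M. M \<ge> 0 \<longrightarrow> (\<forall>t\<in>T. norm (g t) \<le> M) \<longrightarrow>
     (\<Sum>a\<in>A. norm (\<Psi> a g)) \<le> R * M)"

text \<open>
  The families are indexed by initial segments of the naturals, so that the notion can be carried
  through an induction in which the index set changes; \<open>mixed_summingD\<close> recovers arbitrary finite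
  index sets.
\<close>

definition mixed_summing ::
    "'a set \<Rightarrow> 't set \<Rightarrow> ('a \<Rightarrow> ('t \<Rightarrow> 'k::real_normed_vector) \<Rightarrow> 'v::real_normed_vector) \<Rightarrow> real \<Rightarrow> bool" where
  "mixed_summing A T \<Psi> K \<longleftrightarrow> (\<forall>(L::nat) y. (\<forall>t\<in>T. (\<Sum>s<L. (norm (y s t))\<^sup>2) \<le> 1) \<longrightarrow>
     (\<Sum>a\<in>A. sqrt (\<Sum>s<L. (norm (\<Psi> a (y s)))\<^sup>2)) \<le> K)"

lemma mixed_summingD:
  assumes "mixed_summing A T \<Psi> K" "\<And>a. a \<in> A \<Longrightarrow> fun_linear (\<Psi> a)" "finite S" "B > 0"
    and y: "\<And>t. t \<in> T \<Longrightarrow> (\<Sum>s\<in>S. (norm (y s t))\<^sup>2) \<le> B\<^sup>2"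
  shows "(\<Sum>a\<in>A. sqrt (\<Sum>s\<in>S. (norm (\<Psi> a (y s)))\<^sup>2)) \<le> K * B"
proof -
  obtain h where h: "bij_betw h {..<card S} S"
    using ex_bij_betw_nat_finite[OF \<open>finite S\<close>] by (auto simp: atLeast0LessThan)
  have "(\<Sum>s<card S. (norm ((1 / B) *\<^sub>R y (h s) t))\<^sup>2) \<le> 1" if "t \<in> T" for t
  proof -
    have "(\<Sum>s<card S. (norm ((1 / B) *\<^sub>R y (h s) t))\<^sup>2) = (\<Sum>s\<in>S. (norm (y s t))\<^sup>2) / B\<^sup>2"
      using sum.reindex_bij_betw[OF h, of "\<lambda>s. (norm ((1 / B) *\<^sub>R y s t))\<^sup>2"]
      by (simp add: power_divide sum_divide_distrib)
    then show ?thesis using y[OF that] \<open>B > 0\<close> by simp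
  qed
  then have "(\<Sum>a\<in>A. sqrt (\<Sum>s<card S. (norm (\<Psi> a (\<lambda>t. (1 / B) *\<^sub>R y (h s) t)))\<^sup>2)) \<le> K"
    using assms(1) unfolding mixed_summing_def
    by (auto dest!: spec[of _ "card S"] spec[of _ "\<lambda>s t. (1 / B) *\<^sub>R y (h s) t"])
  moreover have "sqrt (\<Sum>s<card S. (norm (\<Psi> a (\<lambda>t. (1 / B) *\<^sub>R y (h s) t)))\<^sup>2)
      = sqrt (\<Sum>s\<in>S. (norm (\<Psi> a (y s)))\<^sup>2) / B" if "a \<in> A" for a
  proof -
    have "(\<Sum>s<card S. (norm (\<Psi> a (\<lambda>t. (1 / B) *\<^sub>R y (h s) t)))\<^sup>2)
      = (\<Sum>s\<in>S. (norm ((1 / B) *\<^sub>R \<Psi> a (y s)))\<^sup>2)"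
      using sum.reindex_bij_betw[OF h, of "\<lambda>s. (norm ((1 / B) *\<^sub>R \<Psi> a (y s)))\<^sup>2"]
      unfolding fun_linear_scaleR[OF assms(2)[OF that]] .
    also have "\<dots> = (\<Sum>s\<in>S. (norm (\<Psi> a (y s)))\<^sup>2) / B\<^sup>2"
      by (simp add: power_divide sum_divide_distrib)
    finally show ?thesis using \<open>B > 0\<close> by (simp add: real_sqrt_divide)
  qed
  ultimately show ?thesis
    using \<open>B > 0\<close> by (simp add: sum_divide_distrib[symmetric] pos_divide_le_eq)
qed

lemma linf_boundedD:
  assumes "linf_bounded A T \<Psi> R" "M \<ge> 0" "\<And>t. t \<in> T \<Longrightarrow> norm (g t) \<le> M"
  shows "(\<Sum>a\<in>A. norm (\<Psi> a g)) \<le> R * M"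
  using assms by (simp add: linf_bounded_def)

text \<open>A crude bound that serves to be finite and independent of \<open>L\<close>, as
  \<open>self_improvement\<close> requires. Each \<Psi> is compared with the \<ell>_2 norm on the
  finite set \<open>T\<close>.\<close>

lemma mixed_summing_linf_bounded:
  fixes R :: real and \<Psi> :: "'a \<Rightarrow> ('t \<Rightarrow> 'k::real_normed_vector) \<Rightarrow> 'v::real_normed_vector"
  assumes "linf_bounded A T \<Psi> R" "finite A" "finite T"
  shows "mixed_summing A T \<Psi> (card A * sqrt (R\<^sup>2 * card T))"
  unfolding mixed_summing_def
proof (intro allI impI)
  fix L :: nat and y :: "nat \<Rightarrow> 't \<Rightarrow> 'k"
  assume y: "\<forall>t\<in>T. (\<Sum>s<L. (norm (y s t))\<^sup>2) \<le> 1"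
  have pt: "(norm (\<Psi> a g))\<^sup>2 \<le> R\<^sup>2 * (\<Sum>t\<in>T. (norm (g t))\<^sup>2)" if "a \<in> A" for a g
  proof -
    have "norm (g t) \<le> sqrt (\<Sum>t\<in>T. (norm (g t))\<^sup>2)" if "t \<in> T" for t
      using that \<open>finite T\<close> by (intro real_le_rsqrt member_le_sum) auto
    then have "(\<Sum>a\<in>A. norm (\<Psi> a g)) \<le> R * sqrt (\<Sum>t\<in>T. (norm (g t))\<^sup>2)"
      using assms(1) unfolding linf_bounded_def by (simp add: sum_nonneg)
    moreover have "norm (\<Psi> a g) \<le> (\<Sum>a\<in>A. norm (\<Psi> a g))"
      using that \<open>finite A\<close> by (intro member_le_sum) auto
    ultimately have "(norm (\<Psi> a g))\<^sup>2 \<le> (R * sqrt (\<Sum>t\<in>T. (norm (g t))\<^sup>2))\<^sup>2"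
      by (intro power_mono) auto
    then show ?thesis by (simp add: power_mult_distrib sum_nonneg)
  qed
  have "sqrt (\<Sum>s<L. (norm (\<Psi> a (y s)))\<^sup>2) \<le> sqrt (R\<^sup>2 * card T)" if "a \<in> A" for a
  proof -
    have "(\<Sum>s<L. (norm (\<Psi> a (y s)))\<^sup>2) \<le> (\<Sum>s<L. R\<^sup>2 * (\<Sum>t\<in>T. (norm (y s t))\<^sup>2))"
      by (intro sum_mono pt that)
    also have "\<dots> = R\<^sup>2 * (\<Sum>t\<in>T. \<Sum>s<L. (norm (y s t))\<^sup>2)"
      by (simp add: sum_distrib_left[symmetric] sum.swap[of _ "{..<L}"])
    also have "\<dots> \<le> R\<^sup>2 * (\<Sum>t\<in>T. 1)"
      using y by (intro mult_left_mono sum_mono) auto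
    finally show ?thesis by simp
  qed
  then show "(\<Sum>a\<in>A. sqrt (\<Sum>s<L. (norm (\<Psi> a (y s)))\<^sup>2)) \<le> card A * sqrt (R\<^sup>2 * card T)"
    by (rule sum_bounded_above)
qed

lemma mixed_summing_self_improvement:
  fixes \<Psi> :: "'a \<Rightarrow> ('t \<Rightarrow> 'k::real_normed_vector) \<Rightarrow> 'v::real_normed_vector"
  assumes "linf_bounded A T \<Psi> R" "finite A" "finite T"
    and improve: "\<And>Q (L::nat) (y :: nat \<Rightarrow> _). mixed_summing A T \<Psi> Q \<Longrightarrow> (\<And>t. t \<in> T \<Longrightarrow> (\<Sum>s<L. (norm (y s t))\<^sup>2) \<le> 1) \<Longrightarrow>
        (\<Sum>a\<in>A. sqrt (\<Sum>s<L. (norm (\<Psi> a (y s)))\<^sup>2)) \<le> c + Q / 2"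
  shows "mixed_summing A T \<Psi> (2 * c)"
proof -
  define D where "D = {(L::nat, y :: nat \<Rightarrow> 't \<Rightarrow> 'k). \<forall>t\<in>T. (\<Sum>s<L. (norm (y s t))\<^sup>2) \<le> 1}"
  define f where "f = (\<lambda>(L::nat, y). \<Sum>a\<in>A. sqrt (\<Sum>s<L. (norm (\<Psi> a (y s)))\<^sup>2))"
  have iff: "mixed_summing A T \<Psi> Q \<longleftrightarrow> (\<forall>x\<in>D. f x \<le> Q)" for Q
    by (auto simp: mixed_summing_def D_def f_def)
  have "f x \<le> 2 * c" if "x \<in> D" for x
  proof (rule self_improvement[OF _ _ that])
    show "f x \<le> card A * sqrt (R\<^sup>2 * card T)" if "x \<in> D" for x
      using mixed_summing_linf_bounded[OF assms(1-3)] that by (auto simp: iff)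
    show "f x \<le> c + Q / 2" if "\<And>x. x \<in> D \<Longrightarrow> f x \<le> Q" "x \<in> D" for Q x
      using improve[of Q "snd x" "fst x"] that by (auto simp: iff f_def D_def split: prod.splits)
  qed
  then show ?thesis by (simp add: iff)
qed

text \<open>The tails of the Rademacher sums form, after rescaling, an admissible family indexed by
  the sign patterns \<open>r\<close>, so any valid constant \<open>Q\<close> applies to
  them.\<close>

lemma mixed_summing_tail:
  fixes \<Psi> :: "'a \<Rightarrow> ('t \<Rightarrow> 'k::real_or_complex) \<Rightarrow> 'v::real_normed_vector" and y :: "'s \<Rightarrow> 't \<Rightarrow> 'k"
  assumes "mixed_summing A T \<Psi> Q" "\<And>a. a \<in> A \<Longrightarrow> fun_linear (\<Psi> a)" "finite S" "D > 0"
    and "\<And>t. t \<in> T \<Longrightarrow> (\<Sum>s\<in>S. (norm (y s t))\<^sup>2) \<le> 1"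
  shows "(\<Sum>a\<in>A. sqrt (\<Sum>r\<in>signs S. (norm (\<Psi> a (\<lambda>t. tail (2 * D) (rademacher S (\<lambda>s. y s t) r))))\<^sup>2))
    \<le> Q * (sqrt (2 ^ card S) / D)"
proof (rule mixed_summingD[OF assms(1,2)])
  show "finite (signs S)" by (rule finite_signs[OF \<open>finite S\<close>])
  show "0 < sqrt (2 ^ card S) / D" using \<open>D > 0\<close> by simp
  fix t assume "t \<in> T"
  then show "(\<Sum>r\<in>signs S. (norm (tail (2 * D) (rademacher S (\<lambda>s. y s t) r)))\<^sup>2)
      \<le> (sqrt (2 ^ card S) / D)\<^sup>2"
    using rademacher_tail[OF \<open>finite S\<close> assms(5) \<open>D > 0\<close>, of t] by (simp add: power_divide)
qed

text \<open>Cotype passes from the \<ell>_2 norm of the \<open>W (y s)\<close> to the quadratic mean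
  over signs of \<open>W (F r)\<close>. The bounded part of \<open>F r\<close> is handled by the
  operator norm for each \<open>r\<close> separately, the tail by \<open>Q\<close>.\<close>

lemma cotype_2_two_summing:
  fixes W :: "('t \<Rightarrow> 'k::real_or_complex) \<Rightarrow> 'z::real_normed_vector"
  assumes lin: "fun_linear W" and "finite T" and bdd: "linf_bounded {()} T (\<lambda>_. W) \<Omega>" and "C > 0"
    and cotype: "\<And>(L::nat) (x :: nat \<Rightarrow> 'z). sqrt (\<Sum>s<L. (norm (x s))\<^sup>2)
       \<le> C * sqrt ((\<Sum>r\<in>signs {..<L}. (norm (rademacher {..<L} x r))\<^sup>2) / 2 ^ L)"
  shows "mixed_summing {()} T (\<lambda>_. W) (8 * C\<^sup>2 * \<Omega>)"
proof -
  have "mixed_summing {()} T (\<lambda>_. W) (2 * (4 * C\<^sup>2 * \<Omega>))"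
  proof (rule mixed_summing_self_improvement[OF bdd])
    fix Q and L :: nat and y :: "nat \<Rightarrow> 't \<Rightarrow> 'k"
    assume Q: "mixed_summing {()} T (\<lambda>_. W) Q"
      and y: "\<And>t. t \<in> T \<Longrightarrow> (\<Sum>s<L. (norm (y s t))\<^sup>2) \<le> 1"
    define F where "F = (\<lambda>r t. rademacher {..<L} (\<lambda>s. y s t) r)"
    \<comment> \<open>With \<open>D = 2 * C\<close> the factor \<open>C\<close> from cotype turns
      the tail term into \<open>Q / 2\<close>, and the level \<open>4 * C\<close> contributes
      \<open>4 * C\<^sup>2 * \<Omega>\<close>.\<close>
    define H where "H = (\<lambda>r t. tail (2 * (2 * C)) (F r t))"
    have H: "L2_set (\<lambda>r. norm (W (H r))) (signs {..<L}) \<le> Q * (sqrt (2 ^ L) / (2 * C))"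
      using mixed_summing_tail[OF Q lin, of "{..<L}" "2 * C" y] \<open>C > 0\<close> y
      by (simp add: L2_set_def H_def F_def)
    have "norm (W (\<lambda>t. F r t - H r t)) \<le> \<Omega> * (4 * C)" for r
      using linf_boundedD[OF bdd, of "4 * C" "\<lambda>t. F r t - H r t"] \<open>C > 0\<close>
      by (simp add: H_def norm_diff_tail)
    then have FH: "L2_set (\<lambda>r. norm (W (\<lambda>t. F r t - H r t))) (signs {..<L})
        \<le> L2_set (\<lambda>r. \<Omega> * (4 * C)) (signs {..<L})"
      by (intro L2_set_mono) auto
    have "0 \<le> \<Omega> * (4 * C)"
      using \<open>norm (W (\<lambda>t. F (\<lambda>_. 0) t - H (\<lambda>_. 0) t)) \<le> \<Omega> * (4 * C)\<close> norm_ge_zero order_trans by blast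
    then have const: "L2_set (\<lambda>r. \<Omega> * (4 * C)) (signs {..<L}) = sqrt (2 ^ L) * (\<Omega> * (4 * C))"
      by (simp add: L2_set_def card_signs real_sqrt_mult)
    have "norm (rademacher {..<L} (\<lambda>s. W (y s)) r) \<le> norm (W (\<lambda>t. F r t - H r t)) + norm (W (H r))" for r
      using norm_triangle_ineq[of "W (\<lambda>t. F r t - H r t)" "W (H r)"]
      by (simp add: fun_linear_diff[OF lin] F_def flip: fun_linear_rademacher[OF lin])
    then have "L2_set (\<lambda>r. norm (rademacher {..<L} (\<lambda>s. W (y s)) r)) (signs {..<L})
      \<le> L2_set (\<lambda>r. norm (W (\<lambda>t. F r t - H r t)) + norm (W (H r))) (signs {..<L})"
      by (intro L2_set_mono) auto
    also have "\<dots> \<le> sqrt (2 ^ L) * (\<Omega> * (4 * C)) + Q * (sqrt (2 ^ L) / (2 * C))"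
      by (rule order_trans[OF L2_set_triangle_ineq]) (use H FH const in linarith)
    also have "\<dots> = sqrt (2 ^ L) * (\<Omega> * (4 * C) + Q / (2 * C))"
      by (simp add: algebra_simps)
    finally have "sqrt ((\<Sum>r\<in>signs {..<L}. (norm (rademacher {..<L} (\<lambda>s. W (y s)) r))\<^sup>2) / 2 ^ L)
        \<le> \<Omega> * (4 * C) + Q / (2 * C)"
      by (simp add: L2_set_def real_sqrt_divide field_simps)
    then have "C * sqrt ((\<Sum>r\<in>signs {..<L}. (norm (rademacher {..<L} (\<lambda>s. W (y s)) r))\<^sup>2) / 2 ^ L)
      \<le> C * (\<Omega> * (4 * C) + Q / (2 * C))"
      using \<open>C > 0\<close> by (intro mult_left_mono) auto
    also have "\<dots> = 4 * C\<^sup>2 * \<Omega> + Q / 2"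
      using \<open>C > 0\<close> by (simp add: field_simps power2_eq_square)
    finally show "(\<Sum>a\<in>{()}. sqrt (\<Sum>s<L. (norm (W (y s)))\<^sup>2)) \<le> 4 * C\<^sup>2 * \<Omega> + Q / 2"
      using cotype[of "\<lambda>s. W (y s)" L] by simp
  qed (use \<open>finite T\<close> in auto)
  then show ?thesis by (simp add: mult.assoc)
qed

text \<open>Khinchine's inequality replaces cotype. Its first moment is used because it commutes
  with the sum over \<open>A\<close>: the bounded part then costs one application of
  \<open>bdd\<close> for each sign pattern. Cauchy-Schwarz returns from first moments to
  \<open>Q\<close> for the tail.\<close>

lemma grothendieck_vector:
  fixes \<Psi> :: "'a \<Rightarrow> ('t \<Rightarrow> 'k::real_or_complex) \<Rightarrow> 'k"
  assumes lin: "\<And>a. a \<in> A \<Longrightarrow> fun_linear (\<Psi> a)" and "finite T" "finite A" and bdd: "linf_bounded A T \<Psi> R"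
  shows "mixed_summing A T \<Psi> (32 * R)"
proof -
  have "mixed_summing A T \<Psi> (2 * (16 * R))"
  proof (rule mixed_summing_self_improvement[OF bdd])
    fix Q and L :: nat and y :: "nat \<Rightarrow> 't \<Rightarrow> 'k"
    assume Q: "mixed_summing A T \<Psi> Q"
      and y: "\<And>t. t \<in> T \<Longrightarrow> (\<Sum>s<L. (norm (y s t))\<^sup>2) \<le> 1"
    let ?S = "signs {..<L}"
    define F where "F = (\<lambda>r t. rademacher {..<L} (\<lambda>s. y s t) r)"
    \<comment> \<open>With \<open>D = 4\<close> the Khinchine factor 2 leaves \<open>Q / 2\<close>
      for the tail; the level 8 times the same factor gives \<open>16 * R\<close>.\<close>
    define H where "H = (\<lambda>r t. tail (2 * 4) (F r t))"
    have H: "(\<Sum>a\<in>A. sqrt (\<Sum>r\<in>?S. (norm (\<Psi> a (H r)))\<^sup>2)) \<le> Q * (sqrt (2 ^ L) / 4)"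
      using mixed_summing_tail[OF Q lin, of "{..<L}" 4 y] y by (simp add: H_def F_def)
    have FH: "(\<Sum>a\<in>A. norm (\<Psi> a (\<lambda>t. F r t - H r t))) \<le> R * 8" for r
      by (rule linf_boundedD[OF bdd]) (simp_all add: H_def norm_diff_tail)
    have cs: "(\<Sum>r\<in>?S. norm (\<Psi> a (H r))) \<le> sqrt (2 ^ L) * sqrt (\<Sum>r\<in>?S. (norm (\<Psi> a (H r)))\<^sup>2)" for a
      using L2_set_mult_ineq[of "\<lambda>_. 1" "\<lambda>r. norm (\<Psi> a (H r))" ?S]
      by (simp add: L2_set_def card_signs)
    have "(\<Sum>a\<in>A. sqrt (\<Sum>s<L. (norm (\<Psi> a (y s)))\<^sup>2)) * 2 ^ L
      \<le> (\<Sum>a\<in>A. 2 * (\<Sum>r\<in>?S. norm (rademacher {..<L} (\<lambda>s. \<Psi> a (y s)) r)))"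
      unfolding sum_distrib_right using khinchine_L1[of "{..<L}"] by (intro sum_mono) simp
    also have "\<dots> \<le> (\<Sum>a\<in>A. 2 * (\<Sum>r\<in>?S. norm (\<Psi> a (\<lambda>t. F r t - H r t)) + norm (\<Psi> a (H r))))"
    proof (intro sum_mono mult_left_mono)
      fix a r assume "a \<in> A"
      then show "norm (rademacher {..<L} (\<lambda>s. \<Psi> a (y s)) r)
          \<le> norm (\<Psi> a (\<lambda>t. F r t - H r t)) + norm (\<Psi> a (H r))"
        using norm_triangle_ineq[of "\<Psi> a (\<lambda>t. F r t - H r t)" "\<Psi> a (H r)"]
        by (simp add: fun_linear_diff[OF lin] F_def flip: fun_linear_rademacher[OF lin])
    qed simp
    also have "\<dots> = 2 * (\<Sum>r\<in>?S. \<Sum>a\<in>A. norm (\<Psi> a (\<lambda>t. F r t - H r t)))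
        + 2 * (\<Sum>a\<in>A. \<Sum>r\<in>?S. norm (\<Psi> a (H r)))"
      by (subst sum.swap) (simp add: sum_distrib_left sum.distrib)
    also have "\<dots> \<le> 2 * (\<Sum>r\<in>?S. R * 8)
        + 2 * (\<Sum>a\<in>A. sqrt (2 ^ L) * sqrt (\<Sum>r\<in>?S. (norm (\<Psi> a (H r)))\<^sup>2))"
      by (intro add_mono mult_left_mono sum_mono FH cs) simp_all
    also have "\<dots> = 16 * R * 2 ^ L
        + 2 * sqrt (2 ^ L) * (\<Sum>a\<in>A. sqrt (\<Sum>r\<in>?S. (norm (\<Psi> a (H r)))\<^sup>2))"
      by (simp add: card_signs sum_distrib_left algebra_simps)
    also have "\<dots> \<le> 16 * R * 2 ^ L + 2 * sqrt (2 ^ L) * (Q * (sqrt (2 ^ L) / 4))"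
      by (intro add_left_mono mult_left_mono H) simp
    also have "\<dots> = (16 * R + Q / 2) * 2 ^ L"
      by (simp add: algebra_simps)
    finally show "(\<Sum>a\<in>A. sqrt (\<Sum>s<L. (norm (\<Psi> a (y s)))\<^sup>2)) \<le> 16 * R + Q / 2"
      by simp
  qed (use assms in auto)
  then show ?thesis by simp
qed

section \<open>Factorisation and tensor products\<close>

text \<open>Tychonoff's theorem: with the coordinates outside \<open>T\<close> pinned to 0, the
  simplex is a closed subset of a product of compact sets even when \<open>'t\<close> is
  infinite.\<close>

lemma compact_simplex:
  fixes T :: "'t set"
  assumes "finite T"
  shows "compact {p :: 't \<Rightarrow> real. (\<forall>t. t \<notin> T \<longrightarrow> p t = 0) \<and> (\<forall>t\<in>T. 0 \<le> p t) \<and> (\<Sum>t\<in>T. p t) = 1}"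
    (is "compact ?S")
proof -
  have "compactin (product_topology (\<lambda>_::'t. euclidean :: real topology) UNIV)
      (PiE UNIV (\<lambda>t. if t \<in> T then {0..1} else {0}))"
    unfolding compactin_PiE by auto
  then have "compact (PiE UNIV (\<lambda>t. if t \<in> T then {0..1::real} else {0}))"
    unfolding euclidean_product_topology by simp
  moreover have "closed {p :: 't \<Rightarrow> real. (\<Sum>t\<in>T. p t) = 1}"
    by (intro closed_Collect_eq continuous_on_sum continuous_on_product_coordinates continuous_intros)
  moreover have "?S = PiE UNIV (\<lambda>t. if t \<in> T then {0..1} else {0}) \<inter> {p. (\<Sum>t\<in>T. p t) = 1}"
  proof -
    have "p t \<le> 1" if "t \<in> T" "\<forall>t\<in>T. 0 \<le> p t" "(\<Sum>t\<in>T. p t) = 1" for p :: "'t \<Rightarrow> real" and t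
      using member_le_sum[of t T p] that assms by simp
    then show ?thesis by (fastforce simp: PiE_iff split: if_splits)
  qed
  ultimately show ?thesis by (simp add: compact_Int_closed)
qed

text \<open>
  Maurey's factorisation argument: the weights are read off from the stationarity condition at a
  point of the simplex where the concave function \<open>p \<mapsto> \<Sum>a. sqrt (\<Sum>t. p t * V t a)\<close> is
  maximal. The summand \<open>\<eta>\<close> makes it differentiable.
\<close>

lemma maurey_weights:
  fixes V :: "'t \<Rightarrow> 'a \<Rightarrow> real"
  assumes "finite T" "T \<noteq> {}" "finite A" and V: "\<And>t a. V t a \<ge> 0" and "C > 0"
    and le: "\<And>p. (\<And>t. t \<in> T \<Longrightarrow> p t \<ge> 0) \<Longrightarrow> (\<Sum>t\<in>T. p t) = 1 \<Longrightarrow>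
        (\<Sum>a\<in>A. sqrt (\<Sum>t\<in>T. p t * V t a)) \<le> C"
  obtains \<mu> where "\<And>a. \<mu> a > 0" "(\<Sum>a\<in>A. \<mu> a) \<le> 2 * C" "\<And>t. t \<in> T \<Longrightarrow> (\<Sum>a\<in>A. V t a / \<mu> a) \<le> C"
proof -
  define \<Delta> where "\<Delta> = {p :: 't \<Rightarrow> real. (\<forall>t. t \<notin> T \<longrightarrow> p t = 0) \<and> (\<forall>t\<in>T. 0 \<le> p t) \<and> (\<Sum>t\<in>T. p t) = 1}"
  \<comment> \<open>Small enough that \<open>card A * sqrt \<eta> \<le> C\<close>; this perturbation
    accounts for the second \<open>C\<close> in the bound \<open>2 * C\<close>.\<close>
  define \<eta> where "\<eta> = (C / (card A + 1))\<^sup>2"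
  define \<Phi> where "\<Phi> p = (\<Sum>a\<in>A. sqrt (\<eta> + (\<Sum>t\<in>T. p t * V t a)))" for p
  have "\<eta> > 0" using \<open>C > 0\<close> by (simp add: \<eta>_def add_nonneg_eq_0_iff)
  have "card A * sqrt \<eta> \<le> C"
    using \<open>C > 0\<close> unfolding \<eta>_def real_sqrt_abs by (simp add: field_simps)
  obtain t1 where "t1 \<in> T" using \<open>T \<noteq> {}\<close> by blast
  then have "(\<lambda>t. of_bool (t = t1)) \<in> \<Delta>"
    using \<open>finite T\<close> by (auto simp: \<Delta>_def of_bool_def)
  moreover have "compact \<Delta>" unfolding \<Delta>_def by (rule compact_simplex[OF \<open>finite T\<close>])
  moreover have "continuous_on \<Delta> \<Phi>"
    unfolding \<Phi>_def
    by (intro continuous_intros continuous_on_subset[OF continuous_on_product_coordinates]) auto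
  ultimately obtain p where "p \<in> \<Delta>" and max: "\<And>q. q \<in> \<Delta> \<Longrightarrow> \<Phi> q \<le> \<Phi> p"
    using continuous_attains_sup[of \<Delta> \<Phi>] by blast
  define f where "f a = (\<Sum>t\<in>T. p t * V t a)" for a
  define \<mu> where "\<mu> a = sqrt (\<eta> + f a)" for a
  have p: "p t \<ge> 0" if "t \<in> T" for t using \<open>p \<in> \<Delta>\<close> that by (simp add: \<Delta>_def)
  have f: "f a \<ge> 0" for a unfolding f_def by (intro sum_nonneg mult_nonneg_nonneg p V)
  have f_le: "(\<Sum>a\<in>A. sqrt (f a)) \<le> C"
    using \<open>p \<in> \<Delta>\<close> unfolding f_def \<Delta>_def by (intro le) auto
  have \<mu>: "\<mu> a > 0" for a using f[of a] \<open>\<eta> > 0\<close> by (simp add: \<mu>_def)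
  have "(\<Sum>a\<in>A. \<mu> a) \<le> (\<Sum>a\<in>A. sqrt \<eta> + sqrt (f a))"
    unfolding \<mu>_def using f \<open>\<eta> > 0\<close> by (intro sum_mono sqrt_add_le_add_sqrt) auto
  also have "\<dots> = card A * sqrt \<eta> + (\<Sum>a\<in>A. sqrt (f a))" by (simp add: sum.distrib)
  finally have sum_\<mu>: "(\<Sum>a\<in>A. \<mu> a) \<le> 2 * C"
    using f_le \<open>card A * sqrt \<eta> \<le> C\<close> by linarith
  have "(\<Sum>a\<in>A. V t a / \<mu> a) \<le> C" if "t \<in> T" for t
  proof -
    \<comment> \<open>The objective along the segment from the maximiser \<open>p\<close> to the
      vertex \<open>t\<close>. Only \<open>s\<close> between 0 and 1 is sure to stay in the simplex,
      so maximality gives a sign for the derivative at 0, not its vanishing.\<close>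
    define g where "g s = (\<Sum>a\<in>A. sqrt (\<eta> + ((1 - s) * f a + s * V t a)))" for s
    define q where "q s = (\<lambda>u. (1 - s) * p u + s * of_bool (u = t))" for s
    have \<Phi>q: "\<Phi> (q s) = g s" for s
    proof -
      have "(\<Sum>u\<in>T. q s u * V u a) = (1 - s) * f a + s * V t a" for a
        using \<open>finite T\<close> that
        by (simp add: q_def f_def distrib_right sum.distrib sum_distrib_left mult.assoc of_bool_def
            if_distrib[of "\<lambda>x. x * _"] if_distrib[of "\<lambda>x. _ * x"] cong: if_cong)
      then show ?thesis by (simp add: \<Phi>_def g_def)
    qed
    have q\<Delta>: "q s \<in> \<Delta>" if "0 \<le> s" "s \<le> 1" for s
      using that \<open>p \<in> \<Delta>\<close> \<open>t \<in> T\<close> \<open>finite T\<close>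
      by (auto simp: \<Delta>_def q_def sum.distrib sum_distrib_left[symmetric] of_bool_def)
    have deriv: "(g has_real_derivative (\<Sum>a\<in>A. (V t a - f a) / (2 * \<mu> a))) (at 0)"
      unfolding g_def
    proof (rule DERIV_sum)
      fix a
      have "\<eta> + f a > 0" using f[of a] \<open>\<eta> > 0\<close> by simp
      then show "((\<lambda>s. sqrt (\<eta> + ((1 - s) * f a + s * V t a))) has_real_derivative
          (V t a - f a) / (2 * \<mu> a)) (at 0)"
        by (auto intro!: derivative_eq_intros simp: \<mu>_def field_simps)
    qed
    have "(\<Sum>a\<in>A. (V t a - f a) / (2 * \<mu> a)) \<le> 0"
    proof (rule ccontr)
      assume "\<not> ?thesis"
      then obtain d where d: "d > 0" "\<And>h. 0 < h \<Longrightarrow> h < d \<Longrightarrow> g 0 < g h"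
        using DERIV_pos_inc_right[OF deriv] by auto
      have "g 0 < g (min (d / 2) 1)" using d by auto
      moreover have "g 0 = \<Phi> p" by (simp add: g_def \<Phi>_def f_def)
      moreover have "g (min (d / 2) 1) \<le> \<Phi> p"
        using max[OF q\<Delta>[of "min (d / 2) 1"]] d(1) by (simp add: \<Phi>q)
      ultimately show False by simp
    qed
    moreover have "(\<Sum>a\<in>A. (V t a - f a) / (2 * \<mu> a)) = ((\<Sum>a\<in>A. V t a / \<mu> a) - (\<Sum>a\<in>A. f a / \<mu> a)) / 2"
      by (simp add: diff_divide_distrib sum_subtractf sum_divide_distrib mult.commute)
    ultimately have "(\<Sum>a\<in>A. V t a / \<mu> a) \<le> (\<Sum>a\<in>A. f a / \<mu> a)" by simp
    also have "\<dots> \<le> (\<Sum>a\<in>A. sqrt (f a))"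
    proof (rule sum_mono)
      fix a
      have "sqrt (f a) * sqrt (f a) \<le> sqrt (f a) * \<mu> a"
        unfolding \<mu>_def using f[of a] \<open>\<eta> > 0\<close> by (intro mult_left_mono) auto
      then show "f a / \<mu> a \<le> sqrt (f a)"
        using f[of a] \<mu>[of a] by (simp add: pos_divide_le_eq)
    qed
    finally show ?thesis using f_le by simp
  qed
  with \<mu> sum_\<mu> show ?thesis by (rule that)
qed

lemma L2_set_sum_le:
  assumes "finite A"
  shows "L2_set (\<lambda>b. \<Sum>a\<in>A. f b a) B \<le> (\<Sum>a\<in>A. L2_set (\<lambda>b. f b a) B)"
  using assms
proof induction
  case (insert x F)
  then show ?case
    using L2_set_triangle_ineq[of "\<lambda>b. f b x" "\<lambda>b. \<Sum>a\<in>F. f b a" B] by simp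
qed (simp add: L2_set_def)

lemma fun_linear_sum_mult:
  "fun_linear (\<lambda>c :: 'i \<Rightarrow> 'k::real_or_complex. \<Sum>i\<in>I. c i * x i)"
  by (simp add: fun_linear_def algebra_simps sum.distrib scaleR_sum_right)

text \<open>Grothendieck's theorem for \<open>X\<close> controls \<open>V\<close> averaged over
  \<open>t\<close>. The weights \<mu> convert this into a bound on the sum over \<open>b\<close> of
  \<open>V t b / \<mu> b\<close>, uniform in \<open>t\<close>. Hence the arrays \<open>G s b\<close>
  divided by \<open>sqrt (\<mu> b)\<close> are admissible for \<Psi> up to scaling, and
  Cauchy-Schwarz over \<open>b\<close> removes the weights again.\<close>

lemma mixed_summing_tensor:
  fixes X :: "'i \<Rightarrow> 'b \<Rightarrow> 'k::real_or_complex"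
    and \<Psi> :: "'a \<Rightarrow> ('t \<Rightarrow> 'k) \<Rightarrow> 'v::real_normed_vector"
  assumes \<Psi>: "mixed_summing A T \<Psi> K" "\<And>a. a \<in> A \<Longrightarrow> fun_linear (\<Psi> a)"
    and X: "linf_bounded B I (\<lambda>b c. \<Sum>i\<in>I. c i * X i b) R"
    and fin: "finite A" "finite B" "finite I" "finite T" "T \<noteq> {}" and "R > 0"
  shows "mixed_summing (B \<times> A) (I \<times> T) (\<lambda>(b, a) y. \<Psi> a (\<lambda>t. \<Sum>i\<in>I. y (i, t) * X i b)) (64 * R * K)"
  unfolding mixed_summing_def
proof (intro allI impI)
  fix L :: nat and y :: "nat \<Rightarrow> 'i \<times> 't \<Rightarrow> 'k"
  assume y: "\<forall>it\<in>I \<times> T. (\<Sum>s<L. (norm (y s it))\<^sup>2) \<le> 1"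
  have "K \<ge> 0" using \<Psi>(1) unfolding mixed_summing_def by (auto dest: spec[of _ 0])
  define G where "G s b t = (\<Sum>i\<in>I. y s (i, t) * X i b)" for s b t
  define V where "V t b = (\<Sum>s<L. (norm (G s b t))\<^sup>2)" for t b
  have GT: "mixed_summing B I (\<lambda>b c. \<Sum>i\<in>I. c i * X i b) (32 * R)"
    using fin by (intro grothendieck_vector fun_linear_sum_mult X)
  \<comment> \<open>The probability weights are absorbed into the arrays: the family
    \<open>sqrt (p t) *\<^sub>R y s (i, t)\<close>, indexed by \<open>(s, t)\<close>, is admissible
    at each \<open>i\<close> because the weights add up to 1.\<close>
  have weighted: "(\<Sum>b\<in>B. sqrt (\<Sum>t\<in>T. p t * V t b)) \<le> 32 * R"
    if p: "\<And>t. t \<in> T \<Longrightarrow> p t \<ge> 0" "(\<Sum>t\<in>T. p t) = 1" for p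
  proof -
    have "(\<Sum>b\<in>B. sqrt (\<Sum>u\<in>{..<L} \<times> T.
        (norm (\<Sum>i\<in>I. (sqrt (p (snd u)) *\<^sub>R y (fst u) (i, snd u)) * X i b))\<^sup>2)) \<le> 32 * R * 1"
    proof (rule mixed_summingD[OF GT fun_linear_sum_mult])
      fix i assume "i \<in> I"
      have "(\<Sum>u\<in>{..<L} \<times> T. (norm (sqrt (p (snd u)) *\<^sub>R y (fst u) (i, snd u)))\<^sup>2)
        = (\<Sum>s<L. \<Sum>t\<in>T. p t * (norm (y s (i, t)))\<^sup>2)"
        unfolding sum.cartesian_product
        by (intro sum.cong) (auto simp: power_mult_distrib p)
      also have "\<dots> = (\<Sum>t\<in>T. p t * (\<Sum>s<L. (norm (y s (i, t)))\<^sup>2))"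
        by (subst sum.swap) (simp add: sum_distrib_left)
      also have "\<dots> \<le> (\<Sum>t\<in>T. p t * 1)"
        using y \<open>i \<in> I\<close> by (intro sum_mono mult_left_mono p) auto
      finally show "(\<Sum>u\<in>{..<L} \<times> T. (norm (sqrt (p (snd u)) *\<^sub>R y (fst u) (i, snd u)))\<^sup>2) \<le> 1\<^sup>2"
        by (simp add: p)
    qed (use fin in auto)
    moreover have "(\<Sum>u\<in>{..<L} \<times> T.
        (norm (\<Sum>i\<in>I. (sqrt (p (snd u)) *\<^sub>R y (fst u) (i, snd u)) * X i b))\<^sup>2) = (\<Sum>t\<in>T. p t * V t b)" for b
    proof -
      have "(\<Sum>u\<in>{..<L} \<times> T.
          (norm (\<Sum>i\<in>I. (sqrt (p (snd u)) *\<^sub>R y (fst u) (i, snd u)) * X i b))\<^sup>2)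
        = (\<Sum>s<L. \<Sum>t\<in>T. p t * (norm (G s b t))\<^sup>2)"
        unfolding sum.cartesian_product
        by (intro sum.cong)
          (auto simp: power_mult_distrib p G_def simp flip: scaleR_sum_right)
      then show ?thesis
        by (subst (asm) sum.swap) (simp add: V_def sum_distrib_left)
    qed
    ultimately show ?thesis by simp
  qed
  obtain \<mu> where \<mu>: "\<And>b. \<mu> b > 0" "(\<Sum>b\<in>B. \<mu> b) \<le> 2 * (32 * R)"
      "\<And>t. t \<in> T \<Longrightarrow> (\<Sum>b\<in>B. V t b / \<mu> b) \<le> 32 * R"
    by (rule maurey_weights[OF fin(4,5,2) _ _ weighted]) (use \<open>R > 0\<close> in \<open>auto simp: V_def sum_nonneg\<close>)
  define N where "N b a = sqrt (\<Sum>s<L. (norm (\<Psi> a (\<lambda>t. (1 / sqrt (\<mu> b)) *\<^sub>R G s b t)))\<^sup>2)" for b a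
  have N: "sqrt (\<Sum>s<L. (norm (\<Psi> a (G s b)))\<^sup>2) = sqrt (\<mu> b) * N b a" if "a \<in> A" for a b
    using \<mu>(1)[of b]
    by (simp add: N_def fun_linear_scaleR[OF \<Psi>(2)[OF that]] power_divide real_sqrt_divide
        flip: sum_divide_distrib)
  have "(\<Sum>a\<in>A. sqrt (\<Sum>u\<in>B \<times> {..<L}.
      (norm (\<Psi> a (\<lambda>t. (1 / sqrt (\<mu> (fst u))) *\<^sub>R G (snd u) (fst u) t)))\<^sup>2)) \<le> K * sqrt (32 * R)"
  proof (rule mixed_summingD[OF \<Psi>])
    fix t assume "t \<in> T"
    have "(\<Sum>u\<in>B \<times> {..<L}. (norm ((1 / sqrt (\<mu> (fst u))) *\<^sub>R G (snd u) (fst u) t))\<^sup>2)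
        = (\<Sum>b\<in>B. V t b / \<mu> b)"
      unfolding V_def sum_divide_distrib sum.cartesian_product
      using \<mu>(1) by (intro sum.cong) (auto simp: power_divide less_imp_le)
    then show "(\<Sum>u\<in>B \<times> {..<L}. (norm ((1 / sqrt (\<mu> (fst u))) *\<^sub>R G (snd u) (fst u) t))\<^sup>2)
        \<le> (sqrt (32 * R))\<^sup>2"
      using \<mu>(3)[OF \<open>t \<in> T\<close>] \<open>R > 0\<close> by simp
  qed (use fin \<open>R > 0\<close> in auto)
  moreover have "sqrt (\<Sum>u\<in>B \<times> {..<L}.
      (norm (\<Psi> a (\<lambda>t. (1 / sqrt (\<mu> (fst u))) *\<^sub>R G (snd u) (fst u) t)))\<^sup>2) = L2_set (\<lambda>b. N b a) B" for a
    by (simp add: L2_set_def N_def sum_nonneg sum.cartesian_product case_prod_beta)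
  ultimately have sumN: "(\<Sum>a\<in>A. L2_set (\<lambda>b. N b a) B) \<le> K * sqrt (32 * R)" by simp
  have "(\<Sum>ba\<in>B \<times> A. sqrt (\<Sum>s<L. (norm ((\<lambda>(b, a) y. \<Psi> a (\<lambda>t. \<Sum>i\<in>I. y (i, t) * X i b)) ba (y s)))\<^sup>2))
    = (\<Sum>b\<in>B. \<Sum>a\<in>A. sqrt (\<mu> b) * N b a)"
    unfolding sum.cartesian_product
    by (intro sum.cong) (auto simp: G_def[symmetric] N)
  also have "\<dots> = (\<Sum>b\<in>B. sqrt (\<mu> b) * (\<Sum>a\<in>A. N b a))"
    by (simp add: sum_distrib_left)
  also have "\<dots> \<le> L2_set (\<lambda>b. sqrt (\<mu> b)) B * L2_set (\<lambda>b. \<Sum>a\<in>A. N b a) B"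
    using L2_set_mult_ineq[of "\<lambda>b. sqrt (\<mu> b)" "\<lambda>b. \<Sum>a\<in>A. N b a" B] \<mu>(1)
    by (simp add: less_imp_le N_def sum_nonneg)
  \<comment> \<open>The first factor is the root of the total mass of \<mu>. In the second,
    Minkowski's inequality pulls the sum over \<open>a\<close> out of the \<ell>_2 norm over
    \<open>b\<close>, which is the order provided by \<open>sumN\<close>.\<close>
  also have "\<dots> \<le> sqrt (64 * R) * (K * sqrt (32 * R))"
  proof (rule mult_mono)
    show "L2_set (\<lambda>b. sqrt (\<mu> b)) B \<le> sqrt (64 * R)"
      using \<mu> by (simp add: L2_set_def less_imp_le)
    show "L2_set (\<lambda>b. \<Sum>a\<in>A. N b a) B \<le> K * sqrt (32 * R)"
      by (rule order_trans[OF L2_set_sum_le[OF \<open>finite A\<close>] sumN])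
  qed (use \<open>R > 0\<close> in auto)
  also have "\<dots> \<le> sqrt (64 * R) * (K * sqrt (64 * R))"
    using \<open>R > 0\<close> \<open>K \<ge> 0\<close> by (intro mult_left_mono real_sqrt_le_mono) auto
  also have "\<dots> = 64 * R * K" using \<open>R > 0\<close> by (simp add: mult.left_commute[of _ K] flip: real_sqrt_mult)
  finally show "(\<Sum>ba\<in>B \<times> A. sqrt (\<Sum>s<L. (norm ((\<lambda>(b, a) y. \<Psi> a (\<lambda>t. \<Sum>i\<in>I. y (i, t) * X i b)) ba (y s)))\<^sup>2))
    \<le> 64 * R * K" .
qed

section \<open>The Hahn-Banach theorem over the reals or the complex numbers\<close>

text \<open>Homogeneity is demanded only as an inequality for \<open>c > 0\<close>; applied to
  \<open>1 / c\<close> it yields its converse.\<close>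

definition sublinear :: "('a::real_vector \<Rightarrow> real) \<Rightarrow> bool" where
  "sublinear q \<longleftrightarrow> (\<forall>x y. q (x + y) \<le> q x + q y) \<and> (\<forall>c x. c > 0 \<longrightarrow> q (c *\<^sub>R x) \<le> c * q x) \<and> q 0 = 0"

lemma sublinear_add: "sublinear q \<Longrightarrow> q (x + y) \<le> q x + q y"
  and sublinear_zero: "sublinear q \<Longrightarrow> q 0 = 0"
  by (simp_all add: sublinear_def)

lemma sublinear_scaleR:
  assumes "sublinear q" "c \<ge> 0"
  shows "q (c *\<^sub>R x) = c * q x"
proof (cases "c = 0")
  case False
  then have "c > 0" using assms(2) by simp
  have "q ((1 / c) *\<^sub>R c *\<^sub>R x) \<le> (1 / c) * q (c *\<^sub>R x)"
    using assms(1) \<open>c > 0\<close> unfolding sublinear_def by (meson zero_less_divide_1_iff)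
  then have "c * q x \<le> q (c *\<^sub>R x)" using \<open>c > 0\<close> by (simp add: field_simps)
  moreover have "q (c *\<^sub>R x) \<le> c * q x" using assms(1) \<open>c > 0\<close> by (simp add: sublinear_def)
  ultimately show ?thesis by simp
qed (simp add: sublinear_zero[OF assms(1)])

lemma sublinear_lower: "sublinear q \<Longrightarrow> - q (- x) \<le> q x"
  using sublinear_add[of q x "- x"] sublinear_zero[of q] by simp

text \<open>This lowers \<open>q\<close> along \<open>u\<close> until the value at
  \<open>- u\<close> is at most \<open>- q u\<close>. A linear functional below
  \<open>tilt q u\<close> is therefore at least \<open>q u\<close> at \<open>u\<close>, which later
  produces norming functionals.\<close>

definition tilt :: "('a::real_vector \<Rightarrow> real) \<Rightarrow> 'a \<Rightarrow> 'a \<Rightarrow> real" where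
  "tilt q u x = (INF t\<in>{0..}. q (x + t *\<^sub>R u) - t * q u)"

lemma tilt_lower:
  assumes "sublinear q" "t \<ge> 0"
  shows "tilt q u x \<le> q (x + t *\<^sub>R u) - t * q u"
proof -
  \<comment> \<open>The real infimum needs a lower bound; this one comes from
    \<open>q (t *\<^sub>R u) \<le> q (x + t *\<^sub>R u) + q (- x)\<close>.\<close>
  have "- q (- x) \<le> q (x + t *\<^sub>R u) - t * q u" if "t \<ge> 0" for t
    using sublinear_add[OF assms(1), of "x + t *\<^sub>R u" "- x"] sublinear_scaleR[OF assms(1) that, of u]
    by simp
  then have "bdd_below ((\<lambda>t. q (x + t *\<^sub>R u) - t * q u) ` {0..})"
    by (intro bdd_belowI2[of _ "- q (- x)"]) auto
  then show ?thesis unfolding tilt_def using assms(2) by (intro cINF_lower) auto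
qed

lemma tilt_greatest:
  assumes "\<And>t. t \<ge> 0 \<Longrightarrow> m \<le> q (x + t *\<^sub>R u) - t * q u"
  shows "m \<le> tilt q u x"
  unfolding tilt_def using assms by (intro cINF_greatest) auto

lemma tilt_le: "sublinear q \<Longrightarrow> tilt q u x \<le> q x"
  using tilt_lower[of q 0 u x] by simp

lemma tilt_uminus: "sublinear q \<Longrightarrow> tilt q u (- u) \<le> - q u"
  using tilt_lower[of q 1 u "- u"] by (simp add: sublinear_zero)

text \<open>Parameters \<open>s\<close> for \<open>x\<close> and \<open>t\<close> for
  \<open>y\<close> combine to the parameter \<open>s + t\<close> for \<open>x + y\<close>; scaling
  by \<open>c\<close> replaces \<open>t\<close> by \<open>c * t\<close>.\<close>

lemma sublinear_tilt:
  assumes "sublinear q"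
  shows "sublinear (tilt q u)"
  unfolding sublinear_def
proof (intro conjI allI impI)
  fix x y
  have "tilt q u (x + y) - tilt q u y \<le> q (x + s *\<^sub>R u) - s * q u" if "s \<ge> 0" for s
  proof -
    have "tilt q u (x + y) - (q (x + s *\<^sub>R u) - s * q u) \<le> q (y + t *\<^sub>R u) - t * q u" if "t \<ge> 0" for t
    proof -
      have "tilt q u (x + y) \<le> q ((x + y) + (s + t) *\<^sub>R u) - (s + t) * q u"
        using \<open>s \<ge> 0\<close> \<open>t \<ge> 0\<close> by (intro tilt_lower[OF assms]) simp
      moreover have "q ((x + y) + (s + t) *\<^sub>R u) \<le> q (x + s *\<^sub>R u) + q (y + t *\<^sub>R u)"
        using sublinear_add[OF assms, of "x + s *\<^sub>R u" "y + t *\<^sub>R u"]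
        by (simp add: scaleR_add_left algebra_simps)
      ultimately show ?thesis by (simp add: algebra_simps)
    qed
    then have "tilt q u (x + y) - (q (x + s *\<^sub>R u) - s * q u) \<le> tilt q u y"
      by (rule tilt_greatest)
    then show ?thesis by simp
  qed
  then have "tilt q u (x + y) - tilt q u y \<le> tilt q u x" by (rule tilt_greatest)
  then show "tilt q u (x + y) \<le> tilt q u x + tilt q u y" by simp
next
  fix c :: real and x assume "c > 0"
  have "tilt q u (c *\<^sub>R x) / c \<le> q (x + t *\<^sub>R u) - t * q u" if "t \<ge> 0" for t
  proof -
    have "tilt q u (c *\<^sub>R x) \<le> q (c *\<^sub>R x + (c * t) *\<^sub>R u) - (c * t) * q u"
      using \<open>c > 0\<close> that by (intro tilt_lower[OF assms]) simp
    also have "\<dots> = c * (q (x + t *\<^sub>R u) - t * q u)"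
      using sublinear_scaleR[OF assms, of c "x + t *\<^sub>R u"] \<open>c > 0\<close>
      by (simp add: scaleR_add_right algebra_simps)
    finally show ?thesis using \<open>c > 0\<close> by (simp add: field_simps)
  qed
  then have "tilt q u (c *\<^sub>R x) / c \<le> tilt q u x" by (rule tilt_greatest)
  then show "tilt q u (c *\<^sub>R x) \<le> c * tilt q u x" using \<open>c > 0\<close> by (simp add: field_simps)
next
  have "0 \<le> tilt q u 0" by (rule tilt_greatest) (simp add: sublinear_scaleR[OF assms])
  then show "tilt q u 0 = 0" using tilt_le[OF assms, of u 0] sublinear_zero[OF assms] by simp
qed

text \<open>
  A minimal sublinear functional \<open>m\<close> below \<open>p\<close> is linear: by minimality it agrees with each
  \<open>tilt m u\<close>, so that \<open>m (- u) \<le> - m u\<close>.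
\<close>

lemma hahn_banach_sublinear:
  fixes p :: "'a::real_vector \<Rightarrow> real"
  assumes "sublinear p"
  shows "\<exists>g. linear g \<and> (\<forall>x. g x \<le> p x)"
proof -
  define A where "A = {q. sublinear q \<and> q \<le> p}"
  have "\<exists>m\<in>A. \<forall>q\<in>A. q \<le> m \<longrightarrow> q = m"
  proof (rule predicate_Zorn[where P = "\<lambda>a b. b \<le> a"])
    show "partial_order_on A (relation_of (\<lambda>a b. b \<le> a) A)"
      by (rule partial_order_on_relation_ofI) auto
  next
    fix C assume C: "C \<in> Chains (relation_of (\<lambda>a b. b \<le> a) A)"
    then have CA: "C \<subseteq> A" and chain: "\<And>a b. a \<in> C \<Longrightarrow> b \<in> C \<Longrightarrow> a \<le> b \<or> b \<le> a"
      by (auto simp: Chains_def relation_of_def)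
    show "\<exists>u\<in>A. \<forall>a\<in>C. u \<le> a"
    proof (cases "C = {}")
      case True
      then show ?thesis using assms by (auto simp: A_def)
    next
      case False
      then obtain q0 where "q0 \<in> C" by blast
      define u where "u x = (INF q\<in>C. q x)" for x
      have sub: "sublinear q" "q \<le> p" if "q \<in> C" for q using that CA by (auto simp: A_def)
      \<comment> \<open>The bound does not depend on \<open>q\<close>, so the pointwise infimum of
        the chain is finite.\<close>
      have "- p (- x) \<le> q x" if "q \<in> C" for q x
        using sublinear_lower[OF sub(1)[OF that], of x] le_funD[OF sub(2)[OF that], of "- x"] by linarith
      then have bdd: "bdd_below ((\<lambda>q. q x) ` C)" for x
        by (intro bdd_belowI2[of _ "- p (- x)"])
      have lower: "u x \<le> q x" if "q \<in> C" for q x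
        unfolding u_def by (rule cINF_lower[OF bdd that])
      have greatest: "c \<le> u x" if "\<And>q. q \<in> C \<Longrightarrow> c \<le> q x" for c x
        unfolding u_def using False that by (rule cINF_greatest)
      have "sublinear u"
        unfolding sublinear_def
      proof (intro conjI allI impI)
        fix x y
        \<comment> \<open>Independent choices of \<open>q1\<close> and \<open>q2\<close> are
          reconciled by the chain property: one of them lies below the other.\<close>
        have *: "u (x + y) \<le> q1 x + q2 y" if q12: "q1 \<in> C" "q2 \<in> C" for q1 q2
        proof -
          obtain q where "q \<in> C" "q x \<le> q1 x" "q y \<le> q2 y"
            using chain[OF q12] q12 by (auto simp: le_fun_def)
          then show ?thesis
            using lower[of q "x + y"] sublinear_add[OF sub(1), of q x y] by simp
        qed
        have "u (x + y) - u y \<le> q1 x" if "q1 \<in> C" for q1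
        proof -
          have "u (x + y) - q1 x \<le> u y" using *[OF that] by (intro greatest) (simp add: algebra_simps)
          then show ?thesis by simp
        qed
        then have "u (x + y) - u y \<le> u x" by (rule greatest)
        then show "u (x + y) \<le> u x + u y" by simp
      next
        fix c :: real and x assume "c > 0"
        have "u (c *\<^sub>R x) / c \<le> q x" if "q \<in> C" for q
          using lower[OF that, of "c *\<^sub>R x"] sublinear_scaleR[OF sub(1)[OF that], of c x] \<open>c > 0\<close>
          by (simp add: field_simps)
        then have "u (c *\<^sub>R x) / c \<le> u x" by (rule greatest)
        then show "u (c *\<^sub>R x) \<le> c * u x" using \<open>c > 0\<close> by (simp add: field_simps)
      next
        have "0 \<le> u 0" using sub sublinear_zero by (intro greatest) force
        then show "u 0 = 0" using lower[OF \<open>q0 \<in> C\<close>, of 0] sublinear_zero[OF sub(1)[OF \<open>q0 \<in> C\<close>]] by simp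
      qed
      moreover have "u \<le> p" using lower[OF \<open>q0 \<in> C\<close>] sub(2)[OF \<open>q0 \<in> C\<close>]
        by (auto simp: le_fun_def intro: order_trans)
      ultimately show ?thesis using lower by (intro bexI[of _ u]) (auto simp: A_def le_fun_def)
    qed
  qed
  then obtain m where "m \<in> A" and min: "\<And>q. q \<in> A \<Longrightarrow> q \<le> m \<Longrightarrow> q = m" by blast
  then have m: "sublinear m" "m \<le> p" by (auto simp: A_def)
  have tilt_m: "tilt m u = m" for u
    using tilt_le[OF m(1)] m(2)
    by (intro min) (auto simp: A_def sublinear_tilt[OF m(1)] le_fun_def intro: order_trans)
  have neg: "m (- u) = - m u" for u
    using tilt_uminus[OF m(1), of u] sublinear_lower[OF m(1), of u] unfolding tilt_m by simp
  have "linear m"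
  proof (rule linearI)
    show "m (x + y) = m x + m y" for x y
      using sublinear_add[OF m(1), of x y] sublinear_add[OF m(1), of "x + y" "- y"] neg[of y] by simp
    show "m (c *\<^sub>R x) = c *\<^sub>R m x" for c x
    proof (cases "c \<ge> 0")
      case False
      then have "m ((- c) *\<^sub>R x) = (- c) * m x" by (intro sublinear_scaleR[OF m(1)]) simp
      then show ?thesis using neg[of "c *\<^sub>R x"] by simp
    qed (simp add: sublinear_scaleR[OF m(1)])
  qed
  then show ?thesis using m(2) by (auto simp: le_fun_def)
qed

text \<open>Dominating by \<open>tilt norm v\<close> instead of \<open>norm\<close> builds the value
  at \<open>v\<close> into the bound, so no functional has to be extended from the line through
  \<open>v\<close>.\<close>

lemma hahn_banach_norming_real:
  fixes v :: "'a::real_normed_vector"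
  shows "\<exists>g. linear g \<and> (\<forall>x. g x \<le> norm x) \<and> norm v \<le> g v"
proof -
  have norm: "sublinear (norm :: 'a \<Rightarrow> real)" by (simp add: sublinear_def norm_triangle_ineq)
  obtain g where g: "linear g" "\<And>x. g x \<le> tilt norm v x"
    using hahn_banach_sublinear[OF sublinear_tilt[OF norm]] by blast
  have "g (- v) \<le> - norm v" using g(2) tilt_uminus[OF norm] by (rule order_trans)
  moreover have "g x \<le> norm x" for x using g(2) tilt_le[OF norm] by (rule order_trans)
  ultimately show ?thesis using g(1) by (auto simp: linear_neg)
qed

context banach_space_over
begin

lemma scale_scaleR_left: "scaleK (a *\<^sub>R c) x = a *\<^sub>R scaleK c x"
  by (metis scaleR_conv_of_real scale_of_real scale_scale)

lemma dual_ballI: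
  assumes "\<And>x y. f (x + y) = f x + f y" "\<And>c x. f (scaleK c x) = c * f x"
    and "\<And>x. norm (f x) \<le> norm x"
  shows "f \<in> dual_ball scaleK"
proof -
  have "f (r *\<^sub>R x) = r *\<^sub>R f x" for r x
    using assms(2)[of "of_real r" x] by (simp add: scale_of_real scaleR_conv_of_real)
  then have "bounded_linear f"
    using assms by (intro bounded_linear_intro[where K = 1]) auto
  moreover have "onorm f \<le> 1" using assms(3) by (intro onorm_bound) auto
  moreover have "Vector_Spaces.linear scaleK (*) f"
    unfolding Vector_Spaces.linear_iff
    using assms vector_space_axioms banach_space_over.axioms(1)[OF banach_space_over_mult] by blast
  ultimately show ?thesis by (simp add: dual_ball_def)
qed

lemma hahn_banach_norming:
  shows "\<exists>f\<in>dual_ball scaleK. norm v \<le> norm (f v)"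
proof -
  obtain g where g: "linear g" "\<And>x. g x \<le> norm x" "norm v \<le> g v"
    using hahn_banach_norming_real[of v] by blast
  note [simp] = linear_add[OF g(1)] linear_diff[OF g(1)] linear_scale[OF g(1)] linear_neg[OF g(1)]
  show ?thesis
    using real_or_complex[where 'a = 'k]
  proof
    assume *: "\<forall>c::'k. \<exists>a. c = a *\<^sub>R 1"
    have "(\<lambda>x. of_real (g x)) \<in> dual_ball scaleK"
    proof (rule dual_ballI)
      fix c :: 'k and x
      obtain a where "c = a *\<^sub>R 1" using * by blast
      then have "c = of_real a" by (simp add: of_real_def)
      then show "of_real (g (scaleK c x)) = c * of_real (g x)" by (simp add: scale_of_real)
    next
      fix x
      show "norm (of_real (g x) :: 'k) \<le> norm x" using g(2)[of x] g(2)[of "- x"] by simp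
    qed simp
    moreover have "norm v \<le> norm (of_real (g v) :: 'k)" using g(3) by simp
    ultimately show ?thesis by (intro bexI[of _ "\<lambda>x. of_real (g x)"])
  next
    assume "\<exists>i::'k. i * i = - 1 \<and> (\<forall>c. \<exists>a b. c = a *\<^sub>R 1 + b *\<^sub>R i) \<and>
       (\<forall>a b. norm (a *\<^sub>R 1 + b *\<^sub>R i) = sqrt (a\<^sup>2 + b\<^sup>2))"
    then obtain i :: 'k where i: "i * i = - 1" and c: "\<And>c. \<exists>a b. c = a *\<^sub>R 1 + b *\<^sub>R i"
      and n: "\<And>a b. norm (a *\<^sub>R 1 + b *\<^sub>R i) = sqrt (a\<^sup>2 + b\<^sup>2)" by blast
    \<comment> \<open>The usual complexification of a real functional, with real part
      \<open>g\<close>.\<close>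
    define f where "f x = g x *\<^sub>R 1 + (- g (scaleK i x)) *\<^sub>R i" for x
    have f_scale: "f (scaleK c x) = c * f x" for c x
    proof -
      obtain a b where ab: "c = a *\<^sub>R 1 + b *\<^sub>R i" using c by blast
      have 1: "scaleK c x = a *\<^sub>R x + b *\<^sub>R scaleK i x"
        by (simp add: ab scale_left_distrib scale_scaleR_left)
      have "i * c = a *\<^sub>R i + b *\<^sub>R (- 1)" by (simp add: ab distrib_left i)
      then have 2: "scaleK i (scaleK c x) = a *\<^sub>R scaleK i x - b *\<^sub>R x"
        by (simp add: scale_left_distrib scale_left_diff_distrib scale_scaleR_left scale_scale)
      show ?thesis
        unfolding f_def 2 unfolding 1 unfolding ab
        by (simp add: algebra_simps i)
    qed
    have "f \<in> dual_ball scaleK"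
    proof (rule dual_ballI[OF _ f_scale])
      fix x y show "f (x + y) = f x + f y" by (simp add: f_def scale_right_distrib algebra_simps)
    next
      fix x
      show "norm (f x) \<le> norm x"
      proof (cases "f x = 0")
        case False
        \<comment> \<open>Rotating \<open>x\<close> makes the value of \<open>f\<close> real and
          nonnegative, hence a value of \<open>g\<close>, which the norm dominates.\<close>
        define \<theta> where "\<theta> = of_real (norm (f x)) / f x"
        have "norm \<theta> = 1" using False by (simp add: \<theta>_def norm_divide)
        have "f (scaleK \<theta> x) = norm (f x) *\<^sub>R 1"
          using False by (simp add: f_scale \<theta>_def scaleR_conv_of_real)
        then have "(g (scaleK \<theta> x) - norm (f x)) *\<^sub>R 1 + (- g (scaleK i (scaleK \<theta> x))) *\<^sub>R i = 0"
          by (simp add: f_def algebra_simps)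
        then have "norm (f x) = g (scaleK \<theta> x)"
          using n[of "g (scaleK \<theta> x) - norm (f x)" "- g (scaleK i (scaleK \<theta> x))"]
          by (simp add: sum_power2_eq_zero_iff)
        also have "\<dots> \<le> norm x" using g(2)[of "scaleK \<theta> x"] by (simp add: norm_scale \<open>norm \<theta> = 1\<close>)
        finally show ?thesis .
      qed simp
    qed
    moreover have "norm v \<le> norm (f v)"
    proof -
      have "norm v \<le> sqrt ((g v)\<^sup>2)" using g(3) by simp
      also have "\<dots> \<le> norm (f v)" unfolding f_def n by (intro real_sqrt_le_mono) simp
      finally show ?thesis .
    qed
    ultimately show ?thesis by blast
  qed
qed

end

section \<open>Weak norms\<close>

lemma ennpowr_1: "ennpowr t 1 = t"
  by (cases t rule: ennreal_cases) (auto simp: ennpowr_def)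

lemma weak_norm_1:
  "weak_norm 1 sc x = (SUP f\<in>dual_ball sc. \<Sum>\<^sub>\<infinity>i. ennreal (norm (f (x i))))"
  by (simp add: weak_norm_def ennpowr_1)

lemma ennreal_sum_le_infsum:
  fixes f :: "'a \<Rightarrow> ennreal"
  assumes "finite F"
  shows "sum f F \<le> infsum f UNIV"
  unfolding nonneg_infsum_complete[where f = f, OF zero_le] using assms by (intro SUP_upper) auto

lemma sum_dual_le_weak_norm:
  assumes "f \<in> dual_ball sc"
  shows "ennreal (\<Sum>i<n. norm (f (x i))) \<le> weak_norm 1 sc x"
proof -
  have "ennreal (\<Sum>i<n. norm (f (x i))) = (\<Sum>i<n. ennreal (norm (f (x i))))"
    by (simp add: sum_ennreal)
  also have "\<dots> \<le> (\<Sum>\<^sub>\<infinity>i. ennreal (norm (f (x i))))"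
    by (rule ennreal_sum_le_infsum) simp
  also have "\<dots> \<le> weak_norm 1 sc x"
    unfolding weak_norm_1 using assms by (rule SUP_upper)
  finally show ?thesis .
qed

context banach_space_over
begin

text \<open>The dual ball separates points. This matters when one weak norm is 0 and another
  infinite: the product on the right of the final estimate is then 0.\<close>

lemma weak_norm_eq_0:
  assumes "weak_norm 1 scaleK x = 0"
  shows "x i = 0"
proof -
  obtain f where f: "f \<in> dual_ball scaleK" "norm (x i) \<le> norm (f (x i))"
    using hahn_banach_norming by blast
  have "(\<Sum>j<Suc i. norm (f (x j))) \<le> 0"
    using sum_dual_le_weak_norm[OF f(1), of x "Suc i"] unfolding assms by (simp add: ennreal_eq_0_iff)
  moreover have "norm (f (x i)) \<le> (\<Sum>j<Suc i. norm (f (x j)))"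
    by (rule member_le_sum) auto
  ultimately have "norm (x i) \<le> 0" using f(2) by linarith
  then show ?thesis by simp
qed

lemma fun_linear_comb: "fun_linear (\<lambda>g :: 't \<Rightarrow> 'k. \<Sum>t\<in>T. scaleK (g t) (z t))"
  by (auto simp: fun_linear_def scale_left_distrib sum.distrib scaleR_sum_right scale_scaleR_left)

lemma dual_ball_sum:
  assumes "f \<in> dual_ball scaleK"
  shows "f (\<Sum>t\<in>T. scaleK (g t) (z t)) = (\<Sum>t\<in>T. g t * f (z t))"
proof -
  interpret f: Vector_Spaces.linear scaleK "(*)" f
    using assms by (simp add: dual_ball_def)
  show ?thesis by (simp add: f.sum f.scale)
qed

text \<open>A norming functional reduces the norm of the combination to the weak sums of
  \<open>z\<close>.\<close>

lemma linf_bounded_comb: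
  assumes "\<And>f. f \<in> dual_ball scaleK \<Longrightarrow> (\<Sum>t\<in>T. norm (f (z t))) \<le> \<Omega>"
  shows "linf_bounded {()} T (\<lambda>_ g. \<Sum>t\<in>T. scaleK (g t) (z t)) \<Omega>"
  unfolding linf_bounded_def
proof (intro allI impI)
  fix g :: "_ \<Rightarrow> 'k" and M :: real assume M: "M \<ge> 0" "\<forall>t\<in>T. norm (g t) \<le> M"
  obtain f where f: "f \<in> dual_ball scaleK"
      "norm (\<Sum>t\<in>T. scaleK (g t) (z t)) \<le> norm (f (\<Sum>t\<in>T. scaleK (g t) (z t)))"
    using hahn_banach_norming by blast
  note f(2)
  also have "norm (f (\<Sum>t\<in>T. scaleK (g t) (z t))) \<le> (\<Sum>t\<in>T. norm (g t * f (z t)))"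
    unfolding dual_ball_sum[OF f(1)] by (rule norm_sum)
  also have "\<dots> \<le> (\<Sum>t\<in>T. norm (f (z t)) * M)"
    using M by (intro sum_mono) (simp add: norm_mult mult.commute mult_right_mono)
  also have "\<dots> \<le> \<Omega> * M"
    using assms[OF f(1)] M(1) by (simp add: sum_distrib_right[symmetric] mult_right_mono)
  finally show "(\<Sum>a\<in>{()}. norm (\<Sum>t\<in>T. scaleK (g t) (z t))) \<le> \<Omega> * M" by simp
qed

end

section \<open>Unit vectors, truncation and duality in \<ell>_1\<close>

lift_definition unit_ell1 :: "nat \<Rightarrow> 'k::real_or_complex ell1" is "\<lambda>a n. of_bool (n = a)"
  by (rule summable_finite[of "{a}" for a]) auto

text \<open>Written as a combination of unit vectors so that multilinearity applies to it
  directly.\<close>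

definition truncate_ell1 :: "nat \<Rightarrow> 'k::real_or_complex ell1 \<Rightarrow> 'k ell1" where
  "truncate_ell1 N x = (\<Sum>a<N. scale_ell1 (coord x a) (unit_ell1 a))"

lemma coord_sum: "coord (\<Sum>a\<in>A. f a) n = (\<Sum>a\<in>A. coord (f a) n)"
  by (induction A rule: infinite_finite_induct) (auto simp: zero_ell1.rep_eq plus_ell1.rep_eq)

lemma coord_truncate: "coord (truncate_ell1 N x) n = (if n < N then coord x n else 0)"
  by (simp add: truncate_ell1_def coord_sum scale_ell1.rep_eq unit_ell1.rep_eq of_bool_def
      if_distrib[of "\<lambda>u. _ * u"] cong: if_cong)

lemma norm_unit_ell1: "norm (unit_ell1 a) = 1"
proof -
  have "(\<lambda>n. norm (of_bool (n = a) :: 'a)) = (\<lambda>n. if n = a then 1 else 0)"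
    by auto
  then show ?thesis by (simp add: norm_ell1.rep_eq unit_ell1.rep_eq sums_unique[OF sums_single, symmetric])
qed

lemma truncate_ell1_tendsto: "(\<lambda>N. truncate_ell1 N x) \<longlonglongrightarrow> x"
proof -
  have "norm (truncate_ell1 N x - x) = (\<Sum>n. norm (coord x n)) - (\<Sum>n<N. norm (coord x n))" for N
  proof -
    have "norm (truncate_ell1 N x - x) = (\<Sum>n. norm (coord x n) - (if n < N then norm (coord x n) else 0))"
      unfolding norm_ell1.rep_eq minus_ell1.rep_eq coord_truncate by (intro suminf_cong) auto
    also have "\<dots> = (\<Sum>n. norm (coord x n)) - (\<Sum>n. if n < N then norm (coord x n) else 0)"
      by (intro suminf_diff[symmetric] summable_coord summable_finite[of "{..<N}"]) auto
    also have "(\<Sum>n. if n < N then norm (coord x n) else 0) = (\<Sum>n<N. norm (coord x n))"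
      by (subst suminf_finite[of "{..<N}"]) auto
    finally show ?thesis .
  qed
  moreover have "(\<lambda>N. (\<Sum>n. norm (coord x n)) - (\<Sum>n<N. norm (coord x n))) \<longlonglongrightarrow>
      (\<Sum>n. norm (coord x n)) - (\<Sum>n. norm (coord x n))"
    by (intro tendsto_intros summable_LIMSEQ summable_coord)
  ultimately have "(\<lambda>N. norm (truncate_ell1 N x - x)) \<longlonglongrightarrow> 0" by simp
  then show ?thesis using LIM_zero_cancel tendsto_norm_zero_iff by blast
qed

text \<open>The conjugate of \<open>w / norm w\<close>, written as a quotient to treat real and
  complex scalars alike.\<close>

definition phase :: "'k::real_or_complex \<Rightarrow> 'k" where
  "phase w = (if w = 0 then 0 else of_real (norm w) / w)"

lemma phase: "phase w * w = of_real (norm w)" "norm (phase w) \<le> 1"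
  by (auto simp: phase_def norm_divide)

lemma dual_ball_ell1:
  fixes \<theta> :: "nat \<Rightarrow> 'k::real_or_complex"
  assumes "\<And>a. norm (\<theta> a) \<le> 1"
  shows "(\<lambda>x. \<Sum>a<N. \<theta> a * coord x a) \<in> dual_ball scale_ell1"
proof (rule banach_space_over.dual_ballI[OF banach_space_over_ell1])
  fix x :: "'k ell1"
  have "norm (\<Sum>a<N. \<theta> a * coord x a) \<le> (\<Sum>a<N. norm (coord x a))"
    by (intro sum_norm_le) (use assms in \<open>simp add: norm_mult mult_left_le_one_le\<close>)
  also have "\<dots> \<le> norm x"
    unfolding norm_ell1.rep_eq by (rule sum_le_suminf) (auto simp: summable_coord)
  finally show "norm (\<Sum>a<N. \<theta> a * coord x a) \<le> norm x" .
qed (simp_all add: plus_ell1.rep_eq scale_ell1.rep_eq distrib_left sum.distrib sum_distrib_left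
    mult.left_commute)

text \<open>The phases of the output coordinates \<open>v b\<close> define a functional in the dual
  ball that realises the \<ell>_1 sum of the output; interchanging sums leaves the weak sums of
  \<open>x\<close>.\<close>

lemma linf_bounded_coord:
  fixes x :: "nat \<Rightarrow> 'k::real_or_complex ell1"
  assumes "\<And>f. f \<in> dual_ball scale_ell1 \<Longrightarrow> (\<Sum>i<n. norm (f (x i) :: 'k)) \<le> R"
  shows "linf_bounded {..<N} {..<n} (\<lambda>b c. \<Sum>i<n. c i * coord (x i) b) R"
  unfolding linf_bounded_def
proof (intro allI impI)
  fix c :: "nat \<Rightarrow> 'k" and M :: real assume M: "M \<ge> 0" "\<forall>i\<in>{..<n}. norm (c i) \<le> M"
  define v where "v b = (\<Sum>i<n. c i * coord (x i) b)" for b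
  define f where "f u = (\<Sum>b<N. phase (v b) * coord u b)" for u
  have f: "f \<in> dual_ball scale_ell1"
    unfolding f_def by (rule dual_ball_ell1) (rule phase)
  have "of_real (\<Sum>b<N. norm (v b)) = (\<Sum>b<N. phase (v b) * v b)"
    by (simp add: phase)
  also have "\<dots> = (\<Sum>i<n. c i * f (x i))"
    unfolding v_def[abs_def] f_def sum_distrib_left
    by (subst sum.swap) (simp add: mult.left_commute v_def)
  finally have "norm (of_real (\<Sum>b<N. norm (v b)) :: 'k) = norm (\<Sum>i<n. c i * f (x i))"
    by (rule arg_cong)
  then have "(\<Sum>b<N. norm (v b)) = norm (\<Sum>i<n. c i * f (x i))"
    by (simp add: sum_nonneg del: of_real_sum)
  also have "\<dots> \<le> (\<Sum>i<n. norm (f (x i)) * M)"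
    using M by (intro sum_norm_le) (simp add: norm_mult mult.commute mult_right_mono)
  also have "\<dots> \<le> R * M"
    using assms[OF f] M(1) by (simp add: sum_distrib_right[symmetric] mult_right_mono)
  finally show "(\<Sum>b<N. norm (\<Sum>i<n. c i * coord (x i) b)) \<le> R * M" by (simp add: v_def)
qed

section \<open>Multilinear forms on finite families\<close>

text \<open>Passes between iterated products and functions on a finite set of slots. For
  \<open>k\<close> an inclusion suffices, since arrays on \<open>T'\<close> are pulled back to
  \<open>T\<close>.\<close>

lemma mixed_summing_reindex:
  fixes \<Psi> :: "'a \<Rightarrow> ('t \<Rightarrow> 'k::real_normed_vector) \<Rightarrow> 'v::real_normed_vector"
    and \<Psi>' :: "'b \<Rightarrow> ('u \<Rightarrow> 'k) \<Rightarrow> 'v"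
  assumes "mixed_summing A T \<Psi> K" "A' = h ` A" "inj_on h A" "k ` T \<subseteq> T'"
    and eq: "\<And>a y. a \<in> A \<Longrightarrow> \<Psi>' (h a) y = \<Psi> a (\<lambda>t. y (k t))"
  shows "mixed_summing A' T' \<Psi>' K"
  unfolding mixed_summing_def
proof (intro allI impI)
  fix L :: nat and y :: "nat \<Rightarrow> 'u \<Rightarrow> 'k"
  assume "\<forall>t\<in>T'. (\<Sum>s<L. (norm (y s t))\<^sup>2) \<le> 1"
  then have "(\<Sum>a\<in>A. sqrt (\<Sum>s<L. (norm (\<Psi> a (\<lambda>t. y s (k t))))\<^sup>2)) \<le> K"
    using assms(1,4) unfolding mixed_summing_def by (simp add: image_subset_iff)
  then show "(\<Sum>a\<in>A'. sqrt (\<Sum>s<L. (norm (\<Psi>' a (y s)))\<^sup>2)) \<le> K"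
    unfolding assms(2) by (simp add: sum.reindex[OF assms(3)] eq)
qed

lemma cotype_2_rademacher:
  assumes "has_cotype 2 TYPE('z::real_normed_vector)"
  obtains C where "C > 0" "\<And>(L::nat) (x :: nat \<Rightarrow> 'z). sqrt (\<Sum>s<L. (norm (x s))\<^sup>2)
       \<le> C * sqrt ((\<Sum>r\<in>signs {..<L}. (norm (rademacher {..<L} x r))\<^sup>2) / 2 ^ L)"
proof -
  obtain C where C: "C > 0" "\<And>(n::nat) (x :: nat \<Rightarrow> 'z).
        (\<Sum>j<n. norm (x j) powr 2) powr (1 / 2) \<le>
        C * sqrt ((\<Sum>\<epsilon>\<in>{..<n} \<rightarrow>\<^sub>E {-1, 1}. (norm (\<Sum>j<n. \<epsilon> j *\<^sub>R x j))\<^sup>2) / 2 ^ n)"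
    using assms unfolding has_cotype_def by blast
  show ?thesis
  proof (rule that[OF C(1)])
    fix L :: nat and x :: "nat \<Rightarrow> 'z"
    show "sqrt (\<Sum>s<L. (norm (x s))\<^sup>2)
       \<le> C * sqrt ((\<Sum>r\<in>signs {..<L}. (norm (rademacher {..<L} x r))\<^sup>2) / 2 ^ L)"
      using C(2)[where n = L and x = x] by (simp add: signs_def rademacher_def powr_half_sqrt sum_nonneg)
  qed
qed

context banach_space_over
begin

text \<open>Each new slot \<open>j\<close> is one application of the tensor lemma, in which the
  previous input index set plays the role of \<open>T\<close>; it costs the factor
  \<open>64 * R j\<close>.\<close>

lemma mixed_summing_PiE:
  fixes X :: "'m \<Rightarrow> nat \<Rightarrow> nat \<Rightarrow> 'k" and z :: "nat \<Rightarrow> 'z"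
  assumes "finite F" and "n > 0"
    and W: "mixed_summing {()} {..<n} (\<lambda>_ g. \<Sum>t<n. scaleK (g t) (z t)) K"
    and X: "\<And>j. linf_bounded {..<N} {..<n} (\<lambda>b c. \<Sum>i<n. c i * X j i b) (R j)" "\<And>j. R j > 0"
  shows "mixed_summing (F \<rightarrow>\<^sub>E {..<N}) ((F \<rightarrow>\<^sub>E {..<n}) \<times> {..<n})
    (\<lambda>a y. \<Sum>t<n. scaleK (\<Sum>i\<in>F \<rightarrow>\<^sub>E {..<n}. y (i, t) * (\<Prod>j\<in>F. X j (i j) (a j))) (z t))
    (K * (\<Prod>j\<in>F. 64 * R j))"
  using \<open>finite F\<close>
proof induction
  case empty
  \<comment> \<open>Without slots there is a single multi-index, the function that is
    \<open>undefined\<close> everywhere, and the products are empty.\<close>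
  have "mixed_summing ({} \<rightarrow>\<^sub>E {..<N}) (({} \<rightarrow>\<^sub>E {..<n}) \<times> {..<n})
    (\<lambda>a y. \<Sum>t<n. scaleK (\<Sum>i\<in>{} \<rightarrow>\<^sub>E {..<n}. y (i, t) * (\<Prod>j\<in>{}. X j (i j) (a j))) (z t)) K"
    by (rule mixed_summing_reindex[OF W, where h = "\<lambda>_. (\<lambda>_. undefined)" and k = "\<lambda>t. (\<lambda>_. undefined, t)"])
       auto
  then show ?case by simp
next
  case (insert j F)
  define \<Psi> where "\<Psi> a y = (\<Sum>t<n. scaleK (\<Sum>i\<in>F \<rightarrow>\<^sub>E {..<n}. y (i, t) * (\<Prod>j\<in>F. X j (i j) (a j))) (z t))"
    for a :: "'m \<Rightarrow> nat" and y :: "('m \<Rightarrow> nat) \<times> nat \<Rightarrow> 'k"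
  have "fun_linear (\<Psi> a)" for a
    unfolding fun_linear_def \<Psi>_def
    by (simp add: distrib_right sum.distrib scale_left_distrib scale_scaleR_left
        flip: scaleR_sum_right)
  moreover have "finite (F \<rightarrow>\<^sub>E {..<N})" "finite (F \<rightarrow>\<^sub>E {..<n})" "F \<rightarrow>\<^sub>E {..<n} \<noteq> {}"
    using \<open>finite F\<close> \<open>n > 0\<close> by (auto intro!: finite_PiE simp: PiE_eq_empty_iff)
  ultimately have tensor: "mixed_summing ({..<N} \<times> (F \<rightarrow>\<^sub>E {..<N})) ({..<n} \<times> ((F \<rightarrow>\<^sub>E {..<n}) \<times> {..<n}))
      (\<lambda>(b, a) y. \<Psi> a (\<lambda>t. \<Sum>i<n. y (i, t) * X j i b)) (64 * R j * (K * (\<Prod>j\<in>F. 64 * R j)))"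
    using \<open>n > 0\<close> by (intro mixed_summing_tensor X insert.IH[folded \<Psi>_def]) auto
  have "mixed_summing (insert j F \<rightarrow>\<^sub>E {..<N}) ((insert j F \<rightarrow>\<^sub>E {..<n}) \<times> {..<n})
    (\<lambda>a y. \<Sum>t<n. scaleK (\<Sum>i\<in>insert j F \<rightarrow>\<^sub>E {..<n}. y (i, t) * (\<Prod>j\<in>insert j F. X j (i j) (a j))) (z t))
    (64 * R j * (K * (\<Prod>j\<in>F. 64 * R j)))"
  proof (rule mixed_summing_reindex[OF tensor, where h = "\<lambda>(b, a). a(j := b)"
        and k = "\<lambda>(i', i, t). (i(j := i'), t)"])
    show "insert j F \<rightarrow>\<^sub>E {..<N} = (\<lambda>(b, a). a(j := b)) ` ({..<N} \<times> (F \<rightarrow>\<^sub>E {..<N}))"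
      by (rule PiE_insert_eq)
    show "inj_on (\<lambda>(b, a). a(j := b)) ({..<N} \<times> (F \<rightarrow>\<^sub>E {..<N}))"
      by (rule inj_combinator) (rule insert.hyps)
    show "(\<lambda>(i', i, t). (i(j := i'), t)) ` ({..<n} \<times> (F \<rightarrow>\<^sub>E {..<n}) \<times> {..<n})
        \<subseteq> (insert j F \<rightarrow>\<^sub>E {..<n}) \<times> {..<n}"
      by (auto simp: PiE_iff extensional_def split: if_splits)
  next
    fix ba :: "nat \<times> ('m \<Rightarrow> nat)" and y :: "('m \<Rightarrow> nat) \<times> nat \<Rightarrow> 'k"
    obtain b a where ba: "ba = (b, a)" by force
    have F: "(\<Prod>u\<in>F. X u ((i(j := i')) u) ((a(j := b)) u)) = (\<Prod>u\<in>F. X u (i u) (a u))" for i i'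
      using insert.hyps by (intro prod.cong) auto
    have "(\<Sum>i\<in>insert j F \<rightarrow>\<^sub>E {..<n}. y (i, t) * (\<Prod>u\<in>insert j F. X u (i u) ((a(j := b)) u)))
      = (\<Sum>i\<in>F \<rightarrow>\<^sub>E {..<n}. (\<Sum>i'<n. y (i(j := i'), t) * X j i' b) * (\<Prod>u\<in>F. X u (i u) (a u)))" for t
      unfolding sum_PiE_insert[OF insert.hyps(2)] sum_distrib_right
      using insert.hyps by (subst sum.swap) (simp add: F mult.assoc fun_upd_same del: fun_upd_apply)
    then show "(\<Sum>t<n. scaleK (\<Sum>i\<in>insert j F \<rightarrow>\<^sub>E {..<n}. y (i, t) *
          (\<Prod>u\<in>insert j F. X u (i u) ((case ba of (b, a) \<Rightarrow> a(j := b)) u))) (z t))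
      = (case ba of (b, a) \<Rightarrow> \<lambda>y. \<Psi> a (\<lambda>t. \<Sum>i<n. y (i, t) * X j i b))
          (\<lambda>t. y (case t of (i', i, t) \<Rightarrow> (i(j := i'), t)))"
      by (simp add: ba \<Psi>_def)
  qed
  then show ?case using insert.hyps by (simp add: mult_ac)
qed

end

section \<open>Expansion of multilinear forms and their values at unit vectors\<close>

lemma continuous_multilinearD:
  assumes "T \<in> continuous_multilinear sX sZ sY"
  shows "Vector_Spaces.linear sX sY (\<lambda>u. T (\<chi> i. if i = j then u else x $ i, z))"
    "Vector_Spaces.linear sZ sY (\<lambda>z. T (x, z))"
    "continuous_on UNIV T"
  using assms by (auto simp: continuous_multilinear_def)

text \<open>The slots outside \<open>F\<close> are frozen at \<open>u\<close>. It stays arbitrary in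
  the induction because expanding the slot \<open>j\<close> freezes it at each \<open>v j b\<close>
  in turn.\<close>

lemma multilinear_expand:
  fixes T :: "('x::real_normed_vector ^ 'm::finite) \<times> 'z::real_normed_vector \<Rightarrow> 'k::real_or_complex"
  assumes T: "T \<in> continuous_multilinear sX sZ (*)" and "finite F"
  shows "T (\<chi> j. if j \<in> F then \<Sum>b\<in>B. sX (c j b) (v j b) else u j, z)
    = (\<Sum>a\<in>F \<rightarrow>\<^sub>E B. (\<Prod>j\<in>F. c j (a j)) * T (\<chi> j. if j \<in> F then v j (a j) else u j, z))"
  using \<open>finite F\<close>
proof (induction arbitrary: u)
  case empty
  then show ?case by simp
next
  case (insert j F)
  interpret lin: Vector_Spaces.linear sX "(*)"
    "\<lambda>w. T (\<chi> i. if i = j then w else (\<chi> i. if i \<in> F then \<Sum>b\<in>B. sX (c i b) (v i b) else u i) $ i, z)"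
    by (rule continuous_multilinearD(1)[OF T])
  have slot: "(\<chi> i. if i = j then w else (\<chi> i. if i \<in> F then \<Sum>b\<in>B. sX (c i b) (v i b) else u i) $ i)
    = (\<chi> i. if i \<in> F then \<Sum>b\<in>B. sX (c i b) (v i b) else (u(j := w)) i)" for w
    using insert.hyps by (auto simp: vec_eq_iff)
  have "(\<chi> i. if i \<in> insert j F then \<Sum>b\<in>B. sX (c i b) (v i b) else u i)
    = (\<chi> i. if i = j then \<Sum>b\<in>B. sX (c j b) (v j b)
         else (\<chi> i. if i \<in> F then \<Sum>b\<in>B. sX (c i b) (v i b) else u i) $ i)"
    by (auto simp: vec_eq_iff)
  then have "T (\<chi> i. if i \<in> insert j F then \<Sum>b\<in>B. sX (c i b) (v i b) else u i, z)
    = (\<Sum>b\<in>B. c j b * T (\<chi> i. if i = j then v j b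
         else (\<chi> i. if i \<in> F then \<Sum>b\<in>B. sX (c i b) (v i b) else u i) $ i, z))"
    by (simp only: lin.sum lin.scale)
  then have "T (\<chi> i. if i \<in> insert j F then \<Sum>b\<in>B. sX (c i b) (v i b) else u i, z)
    = (\<Sum>b\<in>B. c j b * T (\<chi> i. if i \<in> F then \<Sum>b\<in>B. sX (c i b) (v i b) else (u(j := v j b)) i, z))"
    unfolding slot .
  also have "\<dots> = (\<Sum>b\<in>B. \<Sum>a\<in>F \<rightarrow>\<^sub>E B. c j b * ((\<Prod>i\<in>F. c i (a i)) *
      T (\<chi> i. if i \<in> F then v i (a i) else (u(j := v j b)) i, z)))"
    by (simp only: insert.IH sum_distrib_left)
  also have "\<dots> = (\<Sum>a\<in>insert j F \<rightarrow>\<^sub>E B. (\<Prod>i\<in>insert j F. c i (a i)) *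
      T (\<chi> i. if i \<in> insert j F then v i (a i) else u i, z))"
    unfolding sum_PiE_insert[OF insert.hyps(2)]
  proof (intro sum.cong refl)
    fix b a
    have "(\<Prod>i\<in>F. c i ((a(j := b)) i)) = (\<Prod>i\<in>F. c i (a i))"
      using insert.hyps by (intro prod.cong) auto
    moreover have "(\<chi> i. if i \<in> F then v i (a i) else (u(j := v j b)) i)
        = (\<chi> i. if i \<in> insert j F then v i ((a(j := b)) i) else u i)"
      using insert.hyps by (auto simp: vec_eq_iff)
    ultimately show "c j b * ((\<Prod>i\<in>F. c i (a i)) * T (\<chi> i. if i \<in> F then v i (a i) else (u(j := v j b)) i, z))
      = (\<Prod>i\<in>insert j F. c i ((a(j := b)) i)) * T (\<chi> i. if i \<in> insert j F then v i ((a(j := b)) i) else u i, z)"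
      using insert.hyps by (simp add: mult.assoc)
  qed
  finally show ?case .
qed

lemma multilinear_expand_UNIV:
  fixes T :: "('x::real_normed_vector ^ 'm::finite) \<times> 'z::real_normed_vector \<Rightarrow> 'k::real_or_complex"
  assumes "T \<in> continuous_multilinear sX sZ (*)"
  shows "T (\<chi> j. \<Sum>b\<in>B. sX (c j b) (v j b), z)
    = (\<Sum>a\<in>UNIV \<rightarrow>\<^sub>E B. (\<Prod>j\<in>UNIV. c j (a j)) * T (\<chi> j. v j (a j), z))"
  using multilinear_expand[OF assms, where F = UNIV and B = B and c = c and v = v] by simp

context banach_space_over
begin

lemma continuous_multilinear_unit_bound:
  fixes T :: "('k ell1 ^ 'm::finite) \<times> 'z \<Rightarrow> 'k"
  assumes T: "T \<in> continuous_multilinear scale_ell1 scaleK (*)"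
  obtains B where "B > 0" "\<And>a z. norm (T (\<chi> j. unit_ell1 (a j), z)) \<le> B * norm z"
proof -
  interpret Z: Vector_Spaces.linear scaleK "(*)" "\<lambda>z. T (p, z)" for p
    by (rule continuous_multilinearD(2)[OF T])
  have "isCont T 0" using continuous_multilinearD(3)[OF T] by (metis continuous_on_eq_continuous_at open_UNIV UNIV_I)
  moreover have "T 0 = 0" using Z.zero[of 0] by (simp add: zero_prod_def)
  ultimately obtain d where d: "d > 0" "\<And>p. norm p < d \<Longrightarrow> norm (T p) < 1"
    unfolding continuous_at_eps_delta by (metis dist_0_norm dist_commute zero_less_one)
  \<comment> \<open>The \<open>CARD('m)\<close> vectors in \<ell>_1 and the last vector, each of
    norm \<eta>, must have total norm strictly below \<open>d\<close>; hence
    \<open>+ 2\<close>.\<close>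
  define \<eta> where "\<eta> = d / (CARD('m) + 2)"
  have \<eta>: "\<eta> > 0" "(CARD('m) + 1) * \<eta> < d"
    using d(1) by (simp_all add: \<eta>_def field_simps)
  show ?thesis
  proof (rule that[of "1 / \<eta> ^ (CARD('m) + 1)"])
    fix a :: "'m \<Rightarrow> nat" and z
    show "norm (T (\<chi> j. unit_ell1 (a j), z)) \<le> 1 / \<eta> ^ (CARD('m) + 1) * norm z"
    proof (cases "z = 0")
      case True
      then show ?thesis by (simp add: Z.zero)
    next
      case False
      let ?v = "(\<chi> j. scale_ell1 (of_real \<eta>) (unit_ell1 (a j))) :: 'k ell1 ^ 'm"
      let ?w = "scaleK (of_real (\<eta> / norm z)) z"
      have "norm ?v \<le> (\<Sum>j\<in>(UNIV :: 'm set). \<eta>)"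
        unfolding norm_vec_def using \<eta>(1)
        by (rule_tac order_trans[OF L2_set_le_sum])
          (auto simp: banach_space_over.norm_scale[OF banach_space_over_ell1] norm_unit_ell1)
      moreover have "norm ?w = \<eta>" using False \<eta>(1) by (simp add: norm_scale norm_divide)
      ultimately have "norm (?v, ?w) < d"
        using norm_Pair_le[of ?v ?w] \<eta>(2) by (simp add: algebra_simps)
      then have "norm (T (?v, ?w)) < 1" by (rule d(2))
      \<comment> \<open>Over a one-element index set the expansion is plain homogeneity in all
        slots.\<close>
      moreover have "T (?v, ?w) = of_real (\<eta> ^ CARD('m) * (\<eta> / norm z)) * T (\<chi> j. unit_ell1 (a j), z)"
        using multilinear_expand_UNIV[OF T, where B = "{()}" and c = "\<lambda>_ _. of_real \<eta>"
            and v = "\<lambda>j _. unit_ell1 (a j)" and z = ?w]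
        by (simp add: PiE_over_singleton_iff Z.scale mult.assoc)
      ultimately have "\<eta> ^ CARD('m) * (\<eta> / norm z) * norm (T (\<chi> j. unit_ell1 (a j), z)) < 1"
        using \<eta>(1) by (simp add: norm_mult norm_divide norm_power)
      then show ?thesis using False \<eta>(1) by (simp add: field_simps)
    qed
  qed (use \<eta>(1) in simp)
qed

text \<open>The phases \<open>y\<close> make the sum of absolute values linear in the values of
  \<open>T\<close>. Expanding the truncations in unit vectors moves the sums over \<open>i\<close>
  and \<open>t\<close> into the last slot; applying \<open>B\<close> then leaves an \<ell>_1 sum
  over \<open>a\<close> of norms in the last space.\<close>

lemma truncated_sum_bound:
  fixes T :: "('k ell1 ^ 'm::finite) \<times> 'z \<Rightarrow> 'k" and x :: "'m \<Rightarrow> nat \<Rightarrow> 'k ell1"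
  assumes T: "T \<in> continuous_multilinear scale_ell1 scaleK (*)"
    and B: "B > 0" "\<And>a z. norm (T (\<chi> j. unit_ell1 (a j), z)) \<le> B * norm z"
    and W: "mixed_summing {()} {..<n} (\<lambda>_ g. \<Sum>t<n. scaleK (g t) (z t)) K"
    and X: "\<And>j. linf_bounded {..<N} {..<n} (\<lambda>b c. \<Sum>i<n. c i * coord (x j i) b) (R j)"
      "\<And>j. R j > 0"
    and "n > 0"
  shows "(\<Sum>i\<in>UNIV \<rightarrow>\<^sub>E {..<n}. \<Sum>t<n. norm (T (\<chi> j. truncate_ell1 N (x j (i j)), z t)))
    \<le> B * (K * (\<Prod>j\<in>UNIV. 64 * R j))"
proof -
  interpret Z: Vector_Spaces.linear scaleK "(*)" "\<lambda>z. T (p, z)" for p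
    by (rule continuous_multilinearD(2)[OF T])
  let ?I = "(UNIV :: 'm set) \<rightarrow>\<^sub>E {..<n}" and ?A = "(UNIV :: 'm set) \<rightarrow>\<^sub>E {..<N}"
  define \<tau> where "\<tau> i t = T (\<chi> j. truncate_ell1 N (x j (i j)), z t)" for i t
  define P where "P i a = (\<Prod>j\<in>UNIV. coord (x j (i j)) (a j))" for i a :: "'m \<Rightarrow> nat"
  define y where "y = (\<lambda>(i, t). phase (\<tau> i t))"
  have \<tau>: "\<tau> i t = (\<Sum>a\<in>?A. P i a * T (\<chi> j. unit_ell1 (a j), z t))" for i t
    unfolding \<tau>_def truncate_ell1_def P_def by (rule multilinear_expand_UNIV[OF T])
  have "of_real (\<Sum>i\<in>?I. \<Sum>t<n. norm (\<tau> i t)) = (\<Sum>i\<in>?I. \<Sum>t<n. y (i, t) * \<tau> i t)"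
    by (simp add: y_def phase)
  also have "\<dots> = (\<Sum>i\<in>?I. \<Sum>t<n. \<Sum>a\<in>?A. y (i, t) * P i a * T (\<chi> j. unit_ell1 (a j), z t))"
    by (simp add: \<tau> sum_distrib_left mult.assoc)
  also have "\<dots> = (\<Sum>a\<in>?A. \<Sum>t<n. \<Sum>i\<in>?I. y (i, t) * P i a * T (\<chi> j. unit_ell1 (a j), z t))"
    by (simp only: sum.swap[of _ "{..<n}" ?A] sum.swap[of _ ?I ?A] sum.swap[of _ ?I "{..<n}"])
  also have "\<dots> = (\<Sum>a\<in>?A. T (\<chi> j. unit_ell1 (a j), \<Sum>t<n. scaleK (\<Sum>i\<in>?I. y (i, t) * P i a) (z t)))"
    by (simp add: Z.sum Z.scale sum_distrib_right)
  finally have "norm (of_real (\<Sum>i\<in>?I. \<Sum>t<n. norm (\<tau> i t)) :: 'k)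
    = norm (\<Sum>a\<in>?A. T (\<chi> j. unit_ell1 (a j), \<Sum>t<n. scaleK (\<Sum>i\<in>?I. y (i, t) * P i a) (z t)))"
    by (rule arg_cong)
  then have "(\<Sum>i\<in>?I. \<Sum>t<n. norm (\<tau> i t))
    = norm (\<Sum>a\<in>?A. T (\<chi> j. unit_ell1 (a j), \<Sum>t<n. scaleK (\<Sum>i\<in>?I. y (i, t) * P i a) (z t)))"
    by (simp add: sum_nonneg del: of_real_sum)
  also have "\<dots> \<le> (\<Sum>a\<in>?A. B * norm (\<Sum>t<n. scaleK (\<Sum>i\<in>?I. y (i, t) * P i a) (z t)))"
    by (intro sum_norm_le B(2))
  also have "\<dots> \<le> B * (K * (\<Prod>j\<in>UNIV. 64 * R j))"
  proof -
    \<comment> \<open>Only one array is needed: \<open>L\<close> is \<open>Suc 0\<close>, and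
      admissibility says that the phases have modulus at most 1.\<close>
    have "mixed_summing ?A (?I \<times> {..<n})
      (\<lambda>a y. \<Sum>t<n. scaleK (\<Sum>i\<in>?I. y (i, t) * P i a) (z t)) (K * (\<Prod>j\<in>UNIV. 64 * R j))"
      unfolding P_def using \<open>n > 0\<close> by (intro mixed_summing_PiE W X) auto
    moreover have "\<forall>u\<in>?I \<times> {..<n}. (\<Sum>s<Suc 0. (norm (y u))\<^sup>2) \<le> 1"
      by (auto simp: y_def phase power_le_one)
    ultimately have "(\<Sum>a\<in>?A. sqrt (\<Sum>s<Suc 0. (norm (\<Sum>t<n. scaleK (\<Sum>i\<in>?I. y (i, t) * P i a) (z t)))\<^sup>2))
        \<le> K * (\<Prod>j\<in>UNIV. 64 * R j)"
      unfolding mixed_summing_def by (elim allE[of _ "Suc 0"] allE[of _ "\<lambda>_. y"]) blast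
    then show ?thesis using B(1) by (simp add: sum_distrib_left[symmetric])
  qed
  finally show ?thesis by (simp add: \<tau>_def)
qed

text \<open>The bound for truncations is independent of \<open>N\<close>, so it passes to the limit
  by continuity of \<open>T\<close>.\<close>

lemma finite_sum_bound:
  fixes T :: "('k ell1 ^ 'm::finite) \<times> 'z \<Rightarrow> 'k" and x :: "'m \<Rightarrow> nat \<Rightarrow> 'k ell1"
  assumes T: "T \<in> continuous_multilinear scale_ell1 scaleK (*)"
    and B: "B > 0" "\<And>a z. norm (T (\<chi> j. unit_ell1 (a j), z)) \<le> B * norm z"
    and W: "mixed_summing {()} {..<n} (\<lambda>_ g. \<Sum>t<n. scaleK (g t) (z t)) K"
    and X: "\<And>j f. f \<in> dual_ball scale_ell1 \<Longrightarrow> (\<Sum>i<n. norm (f (x j i) :: 'k)) \<le> R j"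
      "\<And>j. R j > 0"
    and "n > 0"
  shows "(\<Sum>i\<in>UNIV \<rightarrow>\<^sub>E {..<n}. \<Sum>t<n. norm (T (\<chi> j. x j (i j), z t)))
    \<le> B * (K * (\<Prod>j\<in>UNIV. 64 * R j))"
proof (rule tendsto_upperbound)
  have "((\<lambda>N. T (\<chi> j. truncate_ell1 N (x j (i j)), z t)) \<longlongrightarrow> T (\<chi> j. x j (i j), z t)) sequentially" for i t
    by (rule continuous_on_tendsto_compose[OF continuous_multilinearD(3)[OF T]])
      (auto intro!: tendsto_Pair tendsto_vec_lambda truncate_ell1_tendsto)
  then show "(\<lambda>N. \<Sum>i\<in>UNIV \<rightarrow>\<^sub>E {..<n}. \<Sum>t<n. norm (T (\<chi> j. truncate_ell1 N (x j (i j)), z t)))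
      \<longlonglongrightarrow> (\<Sum>i\<in>UNIV \<rightarrow>\<^sub>E {..<n}. \<Sum>t<n. norm (T (\<chi> j. x j (i j), z t)))"
    by (intro tendsto_sum tendsto_norm)
  show "\<forall>\<^sub>F N in sequentially. (\<Sum>i\<in>UNIV \<rightarrow>\<^sub>E {..<n}. \<Sum>t<n. norm (T (\<chi> j. truncate_ell1 N (x j (i j)), z t)))
      \<le> B * (K * (\<Prod>j\<in>UNIV. 64 * R j))"
    by (intro always_eventually allI truncated_sum_bound[OF T B W _ X(2) \<open>n > 0\<close>] linf_bounded_coord X(1))
qed simp

end

lemma continuous_multilinear_zero:
  assumes T: "T \<in> continuous_multilinear sX sZ (*)"
  shows "x j = 0 \<Longrightarrow> T (\<chi> i. x i, z) = 0" "T (p, 0) = 0"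
proof -
  interpret X: Vector_Spaces.linear sX "(*)" "\<lambda>u. T (\<chi> i. if i = j then u else (\<chi> i. x i) $ i, z)"
    by (rule continuous_multilinearD(1)[OF T])
  assume "x j = 0"
  then have "(\<chi> i. x i) = (\<chi> i. if i = j then 0 else (\<chi> i. x i) $ i)"
    by (simp add: vec_eq_iff)
  then show "T (\<chi> i. x i, z) = 0" using X.zero by metis
next
  interpret Z: Vector_Spaces.linear sZ "(*)" "\<lambda>z. T (p, z)"
    by (rule continuous_multilinearD(2)[OF T])
  show "T (p, 0) = 0" by (rule Z.zero)
qed

lemma finite_subset_box:
  fixes F :: "(('m::finite \<Rightarrow> nat) \<times> nat) set"
  assumes "finite F"
  obtains n where "n > 0" "F \<subseteq> (UNIV \<rightarrow>\<^sub>E {..<n}) \<times> {..<n}"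
proof -
  define h :: "('m \<Rightarrow> nat) \<times> nat \<Rightarrow> nat" where "h = (\<lambda>(i, k). k + (\<Sum>j\<in>UNIV. i j))"
  have "i j < Suc (sum h F)" "k < Suc (sum h F)" if "(i, k) \<in> F" for i k j
  proof -
    have "h (i, k) \<le> sum h F" using that \<open>finite F\<close> by (intro member_le_sum) auto
    moreover have "i j \<le> (\<Sum>j\<in>UNIV. i j)" by (intro member_le_sum) auto
    ultimately show "i j < Suc (sum h F)" "k < Suc (sum h F)" by (simp_all add: h_def)
  qed
  then have "F \<subseteq> (UNIV \<rightarrow>\<^sub>E {..<Suc (sum h F)}) \<times> {..<Suc (sum h F)}"
    by (auto simp: PiE_iff)
  then show ?thesis by (rule that[rotated]) simp
qed

lemma (in banach_space_over) infsum_bound: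
  fixes T :: "('k ell1 ^ 'm::finite) \<times> 'z \<Rightarrow> 'k" and x :: "'m \<Rightarrow> nat \<Rightarrow> 'k ell1" and z :: "nat \<Rightarrow> 'z"
  assumes T: "T \<in> continuous_multilinear scale_ell1 scaleK (*)"
    and B: "B > 0" "\<And>a z. norm (T (\<chi> j. unit_ell1 (a j), z)) \<le> B * norm z"
    and C: "C > 0" "\<And>(L::nat) (x :: nat \<Rightarrow> 'z). sqrt (\<Sum>s<L. (norm (x s))\<^sup>2)
       \<le> C * sqrt ((\<Sum>r\<in>signs {..<L}. (norm (rademacher {..<L} x r))\<^sup>2) / 2 ^ L)"
  shows "(\<Sum>\<^sub>\<infinity>(i, k)\<in>UNIV. ennreal (norm (T (\<chi> j. x j (i j), z k))))
    \<le> ennreal (B * (8 * C\<^sup>2) * 64 ^ CARD('m)) * (\<Prod>j\<in>UNIV. weak_norm 1 scale_ell1 (x j)) * weak_norm 1 scaleK z"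
    (is "?S \<le> ennreal ?K * _ * _")
proof -
  let ?\<omega> = "\<lambda>j. weak_norm 1 scale_ell1 (x j)" and ?\<Omega> = "weak_norm 1 scaleK z"
  have "?K > 0" using B(1) C(1) by simp
  \<comment> \<open>Zero factors are separated first: 0 times \<infinity> is 0 in
    \<open>ennreal\<close>, so an infinite weak norm makes the bound trivial only if no other factor
    vanishes.\<close>
  consider "\<exists>j. ?\<omega> j = 0" | "?\<Omega> = 0" | "\<forall>j. ?\<omega> j \<noteq> 0" "?\<Omega> \<noteq> 0" "?\<Omega> = \<infinity> \<or> (\<exists>j. ?\<omega> j = \<infinity>)"
    | "\<forall>j. ?\<omega> j \<noteq> 0 \<and> ?\<omega> j \<noteq> \<infinity>" "?\<Omega> \<noteq> 0" "?\<Omega> \<noteq> \<infinity>"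
    by blast
  then show ?thesis
  proof cases
    case 1
    then obtain j where "\<And>i. x j i = 0"
      using banach_space_over.weak_norm_eq_0[OF banach_space_over_ell1] by blast
    then have "T (\<chi> j. x j (i j), z k) = 0" for i k
      by (intro continuous_multilinear_zero(1)[OF T, where j = j])
    then have "?S = 0" by (intro infsum_0) auto
    then show ?thesis by simp
  next
    case 2
    then have "z k = 0" for k by (rule weak_norm_eq_0)
    then have "?S = 0" by (intro infsum_0) (auto simp: continuous_multilinear_zero(2)[OF T])
    then show ?thesis by simp
  next
    case 3
    have "(\<Prod>j\<in>UNIV. ?\<omega> j) \<noteq> 0" using 3(1) by simp
    moreover have "(\<Prod>j\<in>UNIV. ?\<omega> j) = \<infinity> \<or> ?\<Omega> = \<infinity>"
      using 3(1,3) by (auto simp: ennreal_prod_eq_top)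
    ultimately have "ennreal ?K * (\<Prod>j\<in>UNIV. ?\<omega> j) * ?\<Omega> = top"
      using \<open>?K > 0\<close> 3(2) by (auto simp: ennreal_mult_eq_top_iff)
    then show ?thesis by simp
  next
    case 4
    define R where "R j = enn2real (?\<omega> j)" for j
    define \<Omega> where "\<Omega> = enn2real ?\<Omega>"
    have R: "?\<omega> j = ennreal (R j)" "R j > 0" for j
      using 4(1) by (auto simp: R_def enn2real_positive_iff less_top zero_less_iff_neq_zero)
    have \<Omega>: "?\<Omega> = ennreal \<Omega>" "\<Omega> \<ge> 0"
      using 4 by (auto simp: \<Omega>_def less_top)
    have "sum (\<lambda>(i, k). ennreal (norm (T (\<chi> j. x j (i j), z k)))) F
        \<le> ennreal ?K * (\<Prod>j\<in>UNIV. ?\<omega> j) * ?\<Omega>" if F: "finite F" for F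
    proof -
      obtain n where n: "n > 0" "F \<subseteq> (UNIV \<rightarrow>\<^sub>E {..<n}) \<times> {..<n}"
        by (rule finite_subset_box[OF F])
      have "(\<Sum>t<n. norm (f (z t))) \<le> \<Omega>" if "f \<in> dual_ball scaleK" for f
        using sum_dual_le_weak_norm[OF that, of z n] \<Omega> by simp
      then have W: "mixed_summing {()} {..<n} (\<lambda>_ g. \<Sum>t<n. scaleK (g t) (z t)) (8 * C\<^sup>2 * \<Omega>)"
        by (intro cotype_2_two_summing fun_linear_comb linf_bounded_comb C) auto
      have "(\<Sum>i<n. norm (f (x j i) :: 'k)) \<le> R j" if "f \<in> dual_ball scale_ell1" for j f
        using sum_dual_le_weak_norm[OF that, of "x j" n] R[of j] by simp
      then have bound: "(\<Sum>i\<in>UNIV \<rightarrow>\<^sub>E {..<n}. \<Sum>t<n. norm (T (\<chi> j. x j (i j), z t)))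
          \<le> B * (8 * C\<^sup>2 * \<Omega> * (\<Prod>j\<in>UNIV. 64 * R j))"
        by (intro finite_sum_bound[OF T B W] R n(1))
      have "sum (\<lambda>(i, k). ennreal (norm (T (\<chi> j. x j (i j), z k)))) F
        \<le> sum (\<lambda>(i, k). ennreal (norm (T (\<chi> j. x j (i j), z k)))) ((UNIV \<rightarrow>\<^sub>E {..<n}) \<times> {..<n})"
        using n(2) by (intro sum_mono2) (auto intro!: finite_PiE)
      also have "\<dots> = ennreal (\<Sum>i\<in>UNIV \<rightarrow>\<^sub>E {..<n}. \<Sum>t<n. norm (T (\<chi> j. x j (i j), z t)))"
        by (simp add: sum.cartesian_product[symmetric] sum_ennreal sum_nonneg)
      also have "\<dots> \<le> ennreal (B * (8 * C\<^sup>2 * \<Omega> * (\<Prod>j\<in>UNIV. 64 * R j)))"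
        by (rule ennreal_leI) (rule bound)
      also have "B * (8 * C\<^sup>2 * \<Omega> * (\<Prod>j\<in>UNIV. 64 * R j)) = ?K * (\<Prod>j\<in>UNIV. R j) * \<Omega>"
        by (simp add: prod.distrib)
      also have "ennreal \<dots> = ennreal ?K * (\<Prod>j\<in>UNIV. ?\<omega> j) * ?\<Omega>"
        using R(2) \<open>?K > 0\<close> \<Omega>(2)
        by (simp add: R(1) \<Omega>(1) prod_ennreal less_imp_le prod_nonneg ennreal_mult)
      finally show ?thesis .
    qed
    then show ?thesis
      by (subst nonneg_infsum_complete) (auto intro!: SUP_least)
  qed
qed

theorem theorem3p2:
  fixes scaleK :: "'k::real_or_complex \<Rightarrow> 'z::banach \<Rightarrow> 'z"
  assumes "banach_space_over scaleK"
    and "has_cotype 2 TYPE('z)"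
  shows "(continuous_multilinear scale_ell1 scaleK (*) :: (('k ell1 ^ 'm::finite) \<times> 'z \<Rightarrow> 'k) set)
       = multiple_summing 1 1 scale_ell1 scaleK (*)"
proof
  show "multiple_summing 1 1 scale_ell1 scaleK (*)
      \<subseteq> (continuous_multilinear scale_ell1 scaleK (*) :: (('k ell1 ^ 'm::finite) \<times> 'z \<Rightarrow> 'k) set)"
    by (auto simp: multiple_summing_def)
  show "(continuous_multilinear scale_ell1 scaleK (*) :: (('k ell1 ^ 'm::finite) \<times> 'z \<Rightarrow> 'k) set)
      \<subseteq> multiple_summing 1 1 scale_ell1 scaleK (*)"
  proof
    fix T :: "('k ell1 ^ 'm) \<times> 'z \<Rightarrow> 'k"
    assume T: "T \<in> continuous_multilinear scale_ell1 scaleK (*)"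
    interpret banach_space_over scaleK by (rule assms(1))
    obtain B where B: "B > 0" "\<And>a z. norm (T (\<chi> j. unit_ell1 (a j), z)) \<le> B * norm z"
      using continuous_multilinear_unit_bound[OF T] by blast
    obtain C where C: "C > 0" "\<And>(L::nat) (x :: nat \<Rightarrow> 'z). sqrt (\<Sum>s<L. (norm (x s))\<^sup>2)
       \<le> C * sqrt ((\<Sum>r\<in>signs {..<L}. (norm (rademacher {..<L} x r))\<^sup>2) / 2 ^ L)"
      using cotype_2_rademacher[OF assms(2)] by blast
    have "B * (8 * C\<^sup>2) * 64 ^ CARD('m) > 0" using B(1) C(1) by simp
    then show "T \<in> multiple_summing 1 1 scale_ell1 scaleK (*)"
      unfolding multiple_summing_def using T infsum_bound[OF T B C]
      by (intro CollectI conjI exI[of _ "B * (8 * C\<^sup>2) * 64 ^ CARD('m)"]) (simp_all add: ennpowr_1)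
  qed
qed

end
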